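(* Let $N>0$ be an integer. If the homogeneous ideal $\widetilde I_N^*\subset\mathbb C[C_0,C_1,\dots,C_N]$ is radical, then $|V(\widetilde I_N)|=(N-1)\cdot(N-1)!$.
   Context: Let $s_j^{(N)}(c_1,\dots,c_N)$ be the $j$-th elementary symmetric polynomial in $c_1,\dots,c_N$. Put $\alpha_j=s_j^{(N)}(c_1,\dots,c_N)-(-1)^jc_j$ for $j=1,\dots,N$, and $\widetilde\alpha_N=s_{N-1}^{(N-1)}(c_1,\dots,c_{N-1})-(-1)^N=c_1c_2\cdots c_{N-1}-(-1)^N$ (an empty product equals $1$). $\widetilde I_N=\langle\alpha_1,\dots,\alpha_{N-1},\widetilde\alpha_N\rangle\subset\mathbb C[c_1,\dots,c_N]$. The homogenization of a polynomial $\alpha$ of degree $d$ is $\widehat\alpha(C_0,\dots,C_N)=C_0^{d}\,\alpha(C_1/C_0,\dots,C_N/C_0)$. $\widetilde I_N^*$ is the ideal of $\mathbb C[C_0,\dots,C_N]$ generated by the homogenizations of the polynomials $\alpha_1,\dots,\alpha_{N-1},\widetilde\alpha_N$. $V(I)\subset\mathbb C^N$ denotes the set of common zeros of all the polynomials in an ideal $I\subset\mathbb C[c_1,\dots,c_N]$. *)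

theory Defs
  imports Complex_Main "HOL-Library.Poly_Mapping" "HOL-Library.FuncSet" "HOL-Algebra.Ideal"
begin

(* Polynomials are finitely supported maps from monomials (exponent vectors indexed by nat)
   to coefficients; their ring structure is the convolution structure of Poly_Mapping.
   A polynomial ring in finitely many variables is a subring of this type, see poly_ring. *)

type_synonym monom = "nat \<Rightarrow>\<^sub>0 nat"
type_synonym cpoly = "monom \<Rightarrow>\<^sub>0 complex"

definition var :: "nat \<Rightarrow> cpoly"
  where "var i = Poly_Mapping.single (Poly_Mapping.single i 1) 1"

definition vars :: "cpoly \<Rightarrow> nat set"
  where "vars p = (\<Union>m\<in>Poly_Mapping.keys p. Poly_Mapping.keys m)"

definition monom_degree :: "monom \<Rightarrow> nat"
  where "monom_degree m = (\<Sum>i\<in>Poly_Mapping.keys m. Poly_Mapping.lookup m i)"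

(* The zero polynomial gets degree 0. *)
definition total_degree :: "cpoly \<Rightarrow> nat"
  where "total_degree p = Max (insert 0 (monom_degree ` Poly_Mapping.keys p))"

definition eval_monom :: "(nat \<Rightarrow> complex) \<Rightarrow> monom \<Rightarrow> complex"
  where "eval_monom x m = (\<Prod>i\<in>Poly_Mapping.keys m. x i ^ Poly_Mapping.lookup m i)"

definition eval_poly :: "(nat \<Rightarrow> complex) \<Rightarrow> cpoly \<Rightarrow> complex"
  where "eval_poly x p =
    (\<Sum>m\<in>Poly_Mapping.keys p. Poly_Mapping.lookup p m * eval_monom x m)"

(* Intended for p not involving the variable 0, which plays the role of C_0 (and variable i,
   for i > 0, that of both c_i and C_i): each monomial m of p is multiplied by
   C_0 ^ (deg p - deg m).  Lemma eval_homogenize gives the defining formula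
   C_0 ^ deg p * p (C_1 / C_0, ..., C_N / C_0). *)
definition homogenize :: "cpoly \<Rightarrow> cpoly"
  where "homogenize p = (\<Sum>m\<in>Poly_Mapping.keys p.
    Poly_Mapping.single
      (m + Poly_Mapping.single 0 (total_degree p - monom_degree m)) (Poly_Mapping.lookup p m))"

(* The ring of polynomials in the variables with index in A.  Ideals below are ideals of such
   a ring, in the sense of HOL-Algebra. *)
definition poly_ring :: "nat set \<Rightarrow> cpoly ring"
  where "poly_ring A = \<lparr>carrier = {p. vars p \<subseteq> A}, monoid.mult = (*), one = 1, zero = 0, add = (+)\<rparr>"

definition radical :: "('a, 'b) ring_scheme \<Rightarrow> 'a set \<Rightarrow> 'a set"
  where "radical R I = {a \<in> carrier R. \<exists>n::nat. 0 < n \<and> a [^]\<^bsub>R\<^esub> n \<in> I}"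

definition radical_ideal :: "'a set \<Rightarrow> ('a, 'b) ring_scheme \<Rightarrow> bool"
  where "radical_ideal I R \<longleftrightarrow> ideal I R \<and> radical R I = I"

definition elem_sym :: "nat \<Rightarrow> nat \<Rightarrow> cpoly"
  where "elem_sym n j = (\<Sum>S | S \<subseteq> {1..n} \<and> card S = j. \<Prod>i\<in>S. var i)"

definition alpha :: "nat \<Rightarrow> nat \<Rightarrow> cpoly"
  where "alpha N j = elem_sym N j - (- 1) ^ j * var j"

definition alpha_tilde :: "nat \<Rightarrow> cpoly"
  where "alpha_tilde N = elem_sym (N - 1) (N - 1) - (- 1) ^ N"

definition generators :: "nat \<Rightarrow> cpoly set"
  where "generators N = insert (alpha_tilde N) (alpha N ` {1..<N})"

definition I_tilde :: "nat \<Rightarrow> cpoly set"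
  where "I_tilde N = Idl\<^bsub>poly_ring {1..N}\<^esub> (generators N)"

definition I_tilde_star :: "nat \<Rightarrow> cpoly set"
  where "I_tilde_star N = Idl\<^bsub>poly_ring {0..N}\<^esub> (homogenize ` generators N)"

(* Points of N-dimensional space are extensional functions on {1..N}, so that distinct
   functions are distinct points. *)
definition zero_locus :: "nat \<Rightarrow> cpoly set \<Rightarrow> (nat \<Rightarrow> complex) set"
  where "zero_locus N I = {x \<in> {1..N} \<rightarrow>\<^sub>E UNIV. \<forall>p\<in>I. eval_poly x p = 0}"


lemma vars_zero [simp]: "vars 0 = {}"
  and vars_one [simp]: "vars 1 = {}"
  by (simp_all add: vars_def)

lemma vars_uminus [simp]: "vars (- p) = vars p"
  by (simp add: vars_def in_keys_iff set_eq_iff)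

lemma vars_add: "vars (p + q) \<subseteq> vars p \<union> vars q"
  using Poly_Mapping.keys_add[of p q] unfolding vars_def by blast

lemma vars_diff: "vars (p - q) \<subseteq> vars p \<union> vars q"
  using vars_add[of p "- q"] by simp

lemma vars_mult: "vars (p * q) \<subseteq> vars p \<union> vars q"
proof
  fix i assume "i \<in> vars (p * q)"
  then obtain a b where ab: "a \<in> Poly_Mapping.keys p" "b \<in> Poly_Mapping.keys q"
      "i \<in> Poly_Mapping.keys (a + b)"
    unfolding vars_def using Poly_Mapping.keys_mult[of p q] by blast
  then have "i \<in> Poly_Mapping.keys a \<union> Poly_Mapping.keys b"
    using Poly_Mapping.keys_add[of a b] by blast
  with ab show "i \<in> vars p \<union> vars q" unfolding vars_def by blast
qed

lemma vars_var [simp]: "vars (var i) = {i}"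
  by (simp add: vars_def var_def)

lemma vars_sum:
  assumes "\<And>x. x \<in> S \<Longrightarrow> vars (f x) \<subseteq> A"
  shows "vars (sum f S) \<subseteq> A"
  using assms
proof (induction S rule: infinite_finite_induct)
  case (insert x F)
  then have "vars (f x) \<subseteq> A" "vars (sum f F) \<subseteq> A" by auto
  with insert show ?case using vars_add[of "f x" "sum f F"] by auto
qed auto

lemma vars_prod:
  assumes "\<And>x. x \<in> S \<Longrightarrow> vars (f x) \<subseteq> A"
  shows "vars (prod f S) \<subseteq> A"
  using assms
proof (induction S rule: infinite_finite_induct)
  case (insert x F)
  then have "vars (f x) \<subseteq> A" "vars (prod f F) \<subseteq> A" by auto
  with insert show ?case using vars_mult[of "f x" "prod f F"] by auto
qed auto

lemma vars_neg_one_power [simp]: "vars ((- 1) ^ j) = {}"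
  by (cases "even j") simp_all

lemma poly_ring_simps [simp]:
  "carrier (poly_ring A) = {p. vars p \<subseteq> A}"
  "p \<otimes>\<^bsub>poly_ring A\<^esub> q = p * q" "p \<oplus>\<^bsub>poly_ring A\<^esub> q = p + q"
  "\<one>\<^bsub>poly_ring A\<^esub> = 1" "\<zero>\<^bsub>poly_ring A\<^esub> = 0"
  by (simp_all add: poly_ring_def)

lemma cring_poly_ring: "cring (poly_ring A)"
proof (rule cringI)
  show "abelian_group (poly_ring A)"
  proof (rule abelian_groupI; simp?)
    show "vars (x + y) \<subseteq> A" if "vars x \<subseteq> A" "vars y \<subseteq> A" for x y
      using vars_add[of x y] that by blast
    show "\<exists>y. vars y \<subseteq> A \<and> y + x = 0" if "vars x \<subseteq> A" for x
      using that by (intro exI[of _ "- x"]) simp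
  qed
  show "Group.comm_monoid (poly_ring A)"
  proof (rule comm_monoidI; simp?)
    show "vars (x * y) \<subseteq> A" if "vars x \<subseteq> A" "vars y \<subseteq> A" for x y
      using vars_mult[of x y] that by blast
  qed
qed (simp add: algebra_simps)

lemma vars_elem_sym: "vars (elem_sym n j) \<subseteq> {1..n}"
  unfolding elem_sym_def by (intro vars_sum vars_prod) auto

lemma generators_in_carrier: "0 < N \<Longrightarrow> generators N \<subseteq> carrier (poly_ring {1..N})"
  using vars_elem_sym[of N] vars_elem_sym[of "N - 1" "N - 1"]
    vars_diff[of "elem_sym N j" "(- 1) ^ j * var j" for j]
    vars_mult[of "(- 1) ^ j" "var j" for j]
    vars_diff[of "elem_sym (N - 1) (N - 1)" "(- 1) ^ N"]
  by (fastforce simp: generators_def alpha_def alpha_tilde_def)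

lemma vars_homogenize: "vars (homogenize p) \<subseteq> insert 0 (vars p)"
  unfolding homogenize_def
proof (rule vars_sum)
  fix m assume m: "m \<in> Poly_Mapping.keys p"
  let ?e = "Poly_Mapping.single 0 (total_degree p - monom_degree m)"
  have "Poly_Mapping.keys (m + ?e) \<subseteq> insert 0 (Poly_Mapping.keys m)"
    using Poly_Mapping.keys_add[of m ?e] by (auto split: if_splits)
  with m show "vars (Poly_Mapping.single (m + ?e) (Poly_Mapping.lookup p m)) \<subseteq> insert 0 (vars p)"
    unfolding vars_def by auto
qed

lemma homogenize_generators_in_carrier:
  assumes "0 < N"
  shows "homogenize ` generators N \<subseteq> carrier (poly_ring {0..N})"
proof -
  have "vars (homogenize p) \<subseteq> {0..N}" if "p \<in> generators N" for p
  proof -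
    have "vars p \<subseteq> {1..N}" using that generators_in_carrier[OF assms] by auto
    then show ?thesis using vars_homogenize[of p] by fastforce
  qed
  then show ?thesis by auto
qed

lemma eval_monom_superset:
  assumes "finite S" "Poly_Mapping.keys m \<subseteq> S"
  shows "eval_monom x m = (\<Prod>i\<in>S. x i ^ Poly_Mapping.lookup m i)"
  unfolding eval_monom_def using assms
  by (intro prod.mono_neutral_left) (auto simp: in_keys_iff)

lemma eval_monom_add: "eval_monom x (m + m') = eval_monom x m * eval_monom x m'"
proof -
  let ?S = "Poly_Mapping.keys m \<union> Poly_Mapping.keys m'"
  have "Poly_Mapping.keys (m + m') \<subseteq> ?S" by (rule Poly_Mapping.keys_add)
  then show ?thesis
    by (simp add: eval_monom_superset[of ?S] lookup_add power_add prod.distrib)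
qed

lemma eval_monom_single: "eval_monom x (Poly_Mapping.single i k) = x i ^ k"
  by (simp add: eval_monom_def)

lemma eval_poly_superset:
  assumes "finite S" "Poly_Mapping.keys p \<subseteq> S"
  shows "eval_poly x p = (\<Sum>m\<in>S. Poly_Mapping.lookup p m * eval_monom x m)"
  unfolding eval_poly_def using assms
  by (intro sum.mono_neutral_left) (auto simp: in_keys_iff)

lemma eval_poly_add: "eval_poly x (p + q) = eval_poly x p + eval_poly x q"
proof -
  let ?S = "Poly_Mapping.keys p \<union> Poly_Mapping.keys q"
  have "Poly_Mapping.keys (p + q) \<subseteq> ?S" by (rule Poly_Mapping.keys_add)
  then show ?thesis
    by (simp add: eval_poly_superset[of ?S] lookup_add sum.distrib algebra_simps)
qed

lemma eval_poly_single: "eval_poly x (Poly_Mapping.single m a) = a * eval_monom x m"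
  by (simp add: eval_poly_def)

lemma eval_poly_sum: "eval_poly x (sum f S) = (\<Sum>s\<in>S. eval_poly x (f s))"
  by (induction S rule: infinite_finite_induct) (simp_all add: eval_poly_add, simp_all add: eval_poly_def)

lemma eval_homogenize:
  assumes "x 0 \<noteq> 0" "0 \<notin> vars p"
  shows "eval_poly x (homogenize p) = x 0 ^ total_degree p * eval_poly (\<lambda>i. x i / x 0) p"
proof -
  have "eval_monom x m * x 0 ^ (total_degree p - monom_degree m) =
      x 0 ^ total_degree p * eval_monom (\<lambda>i. x i / x 0) m"
    if "m \<in> Poly_Mapping.keys p" for m
  proof -
    have le: "monom_degree m \<le> total_degree p"
      unfolding total_degree_def using that by (intro Max_ge) auto
    have "eval_monom (\<lambda>i. x i / x 0) m = eval_monom x m / x 0 ^ monom_degree m"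
      by (simp add: eval_monom_def monom_degree_def power_divide prod_dividef power_sum)
    with le assms(1) show ?thesis by (simp add: power_diff field_simps)
  qed
  then have "(\<Sum>m\<in>Poly_Mapping.keys p. Poly_Mapping.lookup p m *
        (eval_monom x m * x 0 ^ (total_degree p - monom_degree m))) =
      (\<Sum>m\<in>Poly_Mapping.keys p. Poly_Mapping.lookup p m *
        (x 0 ^ total_degree p * eval_monom (\<lambda>i. x i / x 0) m))"
    by (intro sum.cong) auto
  then show ?thesis
    by (simp add: homogenize_def eval_poly_sum eval_poly_single eval_monom_add eval_monom_single)
      (simp add: eval_poly_def sum_distrib_left algebra_simps)
qed

end

theory Submission
  imports Defs "HOL-Computational_Algebra.Fundamental_Theorem_Algebra"
begin

text \<open>Write \<open>R = \<complex>[c\<^sub>1,\<dots>,c\<^sub>N]\<close> and let \<open>g\<^sub>1,\<dots>,g\<^sub>N\<close> be the generators, of degrees \<open>d\<^sub>i = i\<close> for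
  \<open>i < N\<close> and \<open>d\<^sub>N = N - 1\<close>. Modulo the leading forms of the \<open>g\<^sub>i\<close> and one variable \<open>c\<^sub>k\<close>, Vieta's
  formula gives a tower of monic equations of degrees \<open>N - 1,\<dots>,2,1\<close> for the other variables; splitting
  the leading form \<open>c\<^sub>1\<cdots>c\<^bsub>N-1\<^esub>\<close> of \<open>g\<^sub>N\<close> into its linear factors, \<open>R\<close> is spanned modulo all the
  leading forms by a family of \<open>\<Prod>d\<^sub>i = (N - 1)\<cdot>(N - 1)!\<close> monomials. Hence the products of these
  monomials with the powers of the \<open>g\<^sub>i\<close> span \<open>R\<close> compatibly with the degree. There are exactly as many
  such products of degree at most \<open>m\<close> as monomials of degree at most \<open>m\<close>, so they are a basis of \<open>R\<close>, and
  \<open>R/I\<close> has dimension \<open>(N - 1)\<cdot>(N - 1)!\<close>. If the homogenized ideal is radical, then so is \<open>I\<close>, and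
  the Nullstellensatz for finite-dimensional quotients identifies \<open>R/I\<close> with the functions on \<open>V(I)\<close>.\<close>

section \<open>Polynomials\<close>

text \<open>The term (-1)^j c_j has lower degree than e_j unless j = 1. So the leading forms are e_1
  + c_1, e_2, ..., e_{N-1} and c_1...c_{N-1}, and the extra c_1 is the obstacle. Modulo c_k every
  other variable t satisfies t^n + c_1 t^{n-1} = 0 with n = N - 1; this gives a vanishing power at
  once only for t = c_1, where it reads 2 c_1^n = 0, or when c_1 is the omitted variable. The last
  generator owes its degree N - 1 to the factorization of \<open>alpha N N\<close> as c_N times
  \<open>alpha_tilde N\<close>. Spanning bounds dim R/I only from above. The count by degrees turns
  the bound into an equality and takes the place of regular sequences and Bezout's theorem. It
  requires a spanning statement for every degree bound separately, hence the care with homogeneous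
  components. The dimension bounds the number of zeros; radicality is used for equality, to exclude
  multiple zeros.\<close>

definition Const :: "complex \<Rightarrow> cpoly"
  where "Const c = Poly_Mapping.single 0 c"

definition scale :: "complex \<Rightarrow> cpoly \<Rightarrow> cpoly"
  where "scale c p = Const c * p"

lemma Const_simps [simp]: "Const 0 = 0" "Const 1 = 1"
  by (simp_all add: Const_def)

lemma Const_add: "Const (a + b) = Const a + Const b"
  by (simp add: Const_def single_add)

lemma Const_mult: "Const (a * b) = Const a * Const b"
  by (simp add: Const_def mult_single)

interpretation cp: vector_space scale
  by unfold_locales (simp_all add: scale_def Const_add Const_mult algebra_simps)

lemma scale_single: "scale c (Poly_Mapping.single m a) = Poly_Mapping.single m (c * a)"
  by (simp add: scale_def Const_def mult_single)

lemma cpoly_expand: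
  fixes p :: cpoly
  assumes "finite S" "Poly_Mapping.keys p \<subseteq> S"
  shows "p = (\<Sum>m\<in>S. Poly_Mapping.single m (Poly_Mapping.lookup p m))"
proof (rule poly_mapping_eqI)
  fix k
  show "Poly_Mapping.lookup p k =
      Poly_Mapping.lookup (\<Sum>m\<in>S. Poly_Mapping.single m (Poly_Mapping.lookup p m)) k"
    using assms by (auto simp: lookup_sum lookup_single when_def in_keys_iff)
qed

lemma cpoly_induct [case_names single add]:
  fixes p :: cpoly
  assumes "\<And>m c. P (Poly_Mapping.single m c)" "\<And>p q. P p \<Longrightarrow> P q \<Longrightarrow> P (p + q)"
  shows "P p"
proof -
  have "P (\<Sum>m\<in>S. Poly_Mapping.single m (Poly_Mapping.lookup p m))" if "finite S" for S
    using that
  proof induction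
    case empty
    show ?case using assms(1)[of 0 0] by simp
  next
    case (insert x F)
    then show ?case using assms by simp
  qed
  then show ?thesis by (subst cpoly_expand[of "Poly_Mapping.keys p" p]) simp_all
qed

text \<open>Truncation to a set of monomials, homogenization and dehomogenization are all instances
  of this linear extension, so additivity and multiplicativity need only one proof.\<close>

definition linext :: "(monom \<Rightarrow> cpoly) \<Rightarrow> cpoly \<Rightarrow> cpoly"
  where "linext \<phi> p = (\<Sum>m\<in>Poly_Mapping.keys p. scale (Poly_Mapping.lookup p m) (\<phi> m))"

lemma linext_superset:
  assumes "finite S" "Poly_Mapping.keys p \<subseteq> S"
  shows "linext \<phi> p = (\<Sum>m\<in>S. scale (Poly_Mapping.lookup p m) (\<phi> m))"
  unfolding linext_def using assms
  by (intro sum.mono_neutral_left) (auto simp: in_keys_iff scale_def)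

lemma linext_add: "linext \<phi> (p + q) = linext \<phi> p + linext \<phi> q"
proof -
  let ?S = "Poly_Mapping.keys p \<union> Poly_Mapping.keys q"
  have "Poly_Mapping.keys (p + q) \<subseteq> ?S" by (rule Poly_Mapping.keys_add)
  then show ?thesis
    by (simp add: linext_superset[of ?S] lookup_add sum.distrib cp.scale_left_distrib)
qed

lemma linext_zero [simp]: "linext \<phi> 0 = 0"
  by (simp add: linext_def)

lemma linext_single: "linext \<phi> (Poly_Mapping.single m c) = scale c (\<phi> m)"
  using linext_superset[of "{m}" "Poly_Mapping.single m c"] by simp

lemma linext_sum: "linext \<phi> (sum f S) = (\<Sum>s\<in>S. linext \<phi> (f s))"
  by (induction S rule: infinite_finite_induct) (simp_all add: linext_add)

lemma linext_scale: "linext \<phi> (scale c p) = scale c (linext \<phi> p)"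
  by (induction p rule: cpoly_induct)
    (simp_all add: linext_single scale_single linext_add cp.scale_right_distrib)

lemma linext_cong:
  "(\<And>m. m \<in> Poly_Mapping.keys p \<Longrightarrow> \<phi> m = \<psi> m) \<Longrightarrow> linext \<phi> p = linext \<psi> p"
  by (simp add: linext_def)

lemma linext_id: "linext (\<lambda>m. Poly_Mapping.single m 1) p = p"
  by (induction p rule: cpoly_induct) (simp_all add: linext_single linext_add scale_single)

lemma scale_mult: "scale a p * scale b q = scale (a * b) (p * q)"
  by (simp add: scale_def Const_mult algebra_simps)

text \<open>Three maps, and a condition on the occurring monomials only: homogenization in degrees
  a, b and a + b and homogeneous components are multiplicative just in this joint sense.\<close>

lemma linext_mult:
  assumes "\<And>a b. a \<in> Poly_Mapping.keys p \<Longrightarrow> b \<in> Poly_Mapping.keys q \<Longrightarrow> \<phi> a * \<psi> b = \<chi> (a + b)"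
  shows "linext \<phi> p * linext \<psi> q = linext \<chi> (p * q)"
proof -
  let ?P = "Poly_Mapping.keys p" and ?Q = "Poly_Mapping.keys q"
  let ?l = Poly_Mapping.lookup
  have "p * q = (\<Sum>a\<in>?P. \<Sum>b\<in>?Q. Poly_Mapping.single (a + b) (?l p a * ?l q b))"
    by (subst (1) cpoly_expand[of ?P p], simp, simp, subst (1) cpoly_expand[of ?Q q], simp, simp)
      (simp add: sum_product mult_single)
  then have "linext \<chi> (p * q) = (\<Sum>a\<in>?P. \<Sum>b\<in>?Q. scale (?l p a * ?l q b) (\<chi> (a + b)))"
    by (simp add: linext_sum linext_single)
  also have "\<dots> = (\<Sum>a\<in>?P. \<Sum>b\<in>?Q. scale (?l p a) (\<phi> a) * scale (?l q b) (\<psi> b))"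
    by (intro sum.cong) (simp_all add: scale_mult assms)
  finally show ?thesis by (simp add: linext_def sum_product)
qed

lemma eval_poly_mult: "eval_poly x (p * q) = eval_poly x p * eval_poly x q"
proof (induction p rule: cpoly_induct)
  case (single m c)
  show ?case
    by (induction q rule: cpoly_induct)
      (simp_all add: mult_single eval_poly_single eval_monom_add eval_poly_add algebra_simps)
qed (simp add: eval_poly_add algebra_simps)

lemma eval_poly_zero [simp]: "eval_poly x 0 = 0"
  by (simp add: eval_poly_def)

lemma eval_poly_Const [simp]: "eval_poly x (Const c) = c"
  by (simp add: Const_def eval_poly_single eval_monom_def)

lemma eval_poly_one [simp]: "eval_poly x 1 = 1"
  using eval_poly_Const[of x 1] by simp

lemma eval_poly_scale [simp]: "eval_poly x (scale c p) = c * eval_poly x p"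
  by (simp add: scale_def eval_poly_mult)

lemma eval_poly_var [simp]: "eval_poly x (var i) = x i"
  by (simp add: var_def eval_poly_single eval_monom_single)

lemma eval_poly_minus: "eval_poly x (- p) = - eval_poly x p"
  using eval_poly_add[of x p "- p"] by (simp add: eq_neg_iff_add_eq_0 add.commute)

lemma eval_poly_diff: "eval_poly x (p - q) = eval_poly x p - eval_poly x q"
  using eval_poly_add[of x p "- q"] by (simp add: eval_poly_minus)

lemma eval_poly_prod: "eval_poly x (prod f S) = (\<Prod>s\<in>S. eval_poly x (f s))"
  by (induction S rule: infinite_finite_induct) (simp_all add: eval_poly_mult)

lemma eval_poly_cong:
  assumes "\<And>i. i \<in> vars p \<Longrightarrow> x i = y i"
  shows "eval_poly x p = eval_poly y p"
  unfolding eval_poly_def eval_monom_def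
  using assms by (intro sum.cong arg_cong2[of _ _ _ _ "(*)"] prod.cong) (fastforce simp: vars_def)+

lemma monom_degree_superset:
  assumes "finite S" "Poly_Mapping.keys m \<subseteq> S"
  shows "monom_degree m = (\<Sum>i\<in>S. Poly_Mapping.lookup m i)"
  unfolding monom_degree_def using assms
  by (intro sum.mono_neutral_left) (auto simp: in_keys_iff)

lemma monom_degree_add: "monom_degree (a + b) = monom_degree a + monom_degree b"
proof -
  let ?S = "Poly_Mapping.keys a \<union> Poly_Mapping.keys b"
  have "Poly_Mapping.keys (a + b) \<subseteq> ?S" by (rule Poly_Mapping.keys_add)
  then show ?thesis
    by (simp add: monom_degree_superset[of ?S] lookup_add sum.distrib)
qed

lemma monom_degree_single [simp]: "monom_degree (Poly_Mapping.single i k) = k"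
  by (simp add: monom_degree_def)

lemma monom_degree_zero [simp]: "monom_degree 0 = 0"
  by (simp add: monom_degree_def)

lemma keys_add_monom:
  "Poly_Mapping.keys (a + b :: monom) = Poly_Mapping.keys a \<union> Poly_Mapping.keys b"
  by (auto simp: in_keys_iff lookup_add)

lemma cpoly_generated:
  assumes "\<And>c. Const c \<in> T" "\<And>i. var i \<in> T"
    and "\<And>p q. p \<in> T \<Longrightarrow> q \<in> T \<Longrightarrow> p + q \<in> T" "\<And>p q. p \<in> T \<Longrightarrow> q \<in> T \<Longrightarrow> p * q \<in> T"
  shows "p \<in> T"
proof (induction p rule: cpoly_induct)
  case (single m c)
  have pw: "Poly_Mapping.single (Poly_Mapping.single i k) 1 \<in> T" for i k
  proof (induction k)
    case 0 show ?case using assms(1)[of 1] by simp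
  next
    case (Suc k)
    have "Poly_Mapping.single (Poly_Mapping.single i (Suc k)) 1 =
      var i * (Poly_Mapping.single (Poly_Mapping.single i k) 1 :: cpoly)"
      by (simp add: var_def mult_single flip: single_add)
    with Suc assms show ?case by simp
  qed
  have "Poly_Mapping.single (\<Sum>i\<in>S. Poly_Mapping.single i (Poly_Mapping.lookup m i)) 1 \<in> T"
    if "finite S" for S
    using that
  proof induction
    case empty
    show ?case using assms(1)[of 1] by simp
  next
    case (insert i F)
    have "Poly_Mapping.single (\<Sum>i\<in>insert i F. Poly_Mapping.single i (Poly_Mapping.lookup m i)) 1 =
      Poly_Mapping.single (Poly_Mapping.single i (Poly_Mapping.lookup m i)) 1 *
      (Poly_Mapping.single (\<Sum>i\<in>F. Poly_Mapping.single i (Poly_Mapping.lookup m i)) 1 :: cpoly)"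
      using insert by (simp add: mult_single)
    with insert pw assms show ?case by simp
  qed
  moreover have "m = (\<Sum>i\<in>Poly_Mapping.keys m. Poly_Mapping.single i (Poly_Mapping.lookup m i))"
    by (rule poly_mapping_eqI) (auto simp: lookup_sum lookup_single when_def in_keys_iff)
  ultimately have "Poly_Mapping.single m 1 \<in> T" by (metis finite_keys)
  then have "Const c * Poly_Mapping.single m 1 \<in> T" using assms by blast
  then show ?case by (simp add: Const_def mult_single)
qed (use assms in blast)

section \<open>Ideals and elementary symmetric polynomials\<close>

text \<open>An ideal of the whole type, with a variable for every natural number, so that no carrier
  conditions arise. An ideal of the ring in c_1, ..., c_N enters as its preimage under the
  projection that kills all other variables.\<close>

definition is_ideal :: "cpoly set \<Rightarrow> bool"
  where "is_ideal L \<longleftrightarrow> 0 \<in> L \<and> (\<forall>p\<in>L. \<forall>q\<in>L. p + q \<in> L) \<and> (\<forall>p. \<forall>q\<in>L. p * q \<in> L)"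

lemma is_ideal_zero: "is_ideal L \<Longrightarrow> 0 \<in> L"
  and is_ideal_add: "is_ideal L \<Longrightarrow> p \<in> L \<Longrightarrow> q \<in> L \<Longrightarrow> p + q \<in> L"
  and is_ideal_mult: "is_ideal L \<Longrightarrow> q \<in> L \<Longrightarrow> p * q \<in> L"
  by (auto simp: is_ideal_def)

lemma is_ideal_mult_right: "is_ideal L \<Longrightarrow> q \<in> L \<Longrightarrow> q * p \<in> L"
  by (metis is_ideal_mult mult.commute)

lemma is_ideal_minus: "is_ideal L \<Longrightarrow> q \<in> L \<Longrightarrow> - q \<in> L"
  using is_ideal_mult[of L q "-1"] by simp

lemma is_ideal_diff: "is_ideal L \<Longrightarrow> p \<in> L \<Longrightarrow> q \<in> L \<Longrightarrow> p - q \<in> L"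
  using is_ideal_add[of L p "- q"] is_ideal_minus by simp

lemma is_ideal_sum: "is_ideal L \<Longrightarrow> (\<And>i. i \<in> S \<Longrightarrow> f i \<in> L) \<Longrightarrow> sum f S \<in> L"
  by (induction S rule: infinite_finite_induct) (auto simp: is_ideal_zero is_ideal_add)

lemma is_ideal_scale: "is_ideal L \<Longrightarrow> q \<in> L \<Longrightarrow> scale c q \<in> L"
  by (simp add: scale_def is_ideal_mult)

text \<open>For an ideal \<open>L\<close> this is the sum of \<open>L\<close> and the principal
  ideal of \<open>a\<close>.\<close>

definition adjoin :: "cpoly set \<Rightarrow> cpoly \<Rightarrow> cpoly set"
  where "adjoin L a = {l + a * h |l h. l \<in> L}"

lemma is_ideal_adjoin:
  assumes "is_ideal L"
  shows "is_ideal (adjoin L a)"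
  unfolding is_ideal_def
proof (intro conjI ballI allI)
  show "0 \<in> adjoin L a"
    unfolding adjoin_def using is_ideal_zero[OF assms] by (auto intro!: exI[of _ 0])
  fix p q assume q: "q \<in> adjoin L a"
  then obtain l h where lh: "q = l + a * h" "l \<in> L" by (auto simp: adjoin_def)
  show "p + q \<in> adjoin L a" if "p \<in> adjoin L a"
  proof -
    from that obtain l' h' where "p = l' + a * h'" "l' \<in> L" by (auto simp: adjoin_def)
    with lh have "p + q = (l' + l) + a * (h' + h)" "l' + l \<in> L"
      using assms by (auto simp: algebra_simps is_ideal_add)
    then show ?thesis unfolding adjoin_def by blast
  qed
  have "p * q = p * l + a * (p * h)" using lh by (simp add: algebra_simps)
  moreover have "p * l \<in> L" using lh assms by (simp add: is_ideal_mult)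
  ultimately show "p * q \<in> adjoin L a" unfolding adjoin_def by blast
qed

lemma adjoin_incl: "L \<subseteq> adjoin L a"
  unfolding adjoin_def by (force intro: exI[of _ 0])

lemma adjoin_self:
  assumes "is_ideal L"
  shows "a \<in> adjoin L a"
proof -
  have "a = 0 + a * 1" by simp
  then show ?thesis unfolding adjoin_def using is_ideal_zero[OF assms] by blast
qed

section \<open>Adjoining the powers of one element to a span\<close>

definition mult_closed :: "cpoly set \<Rightarrow> bool"
  where "mult_closed W \<longleftrightarrow> (\<forall>p\<in>W. \<forall>q\<in>W. p * q \<in> W)"

definition extend_basis :: "cpoly set \<Rightarrow> cpoly \<Rightarrow> nat \<Rightarrow> cpoly set"
  where "extend_basis M z d = {z ^ a * x |a x. a < d \<and> x \<in> M}"

lemma subspace_mult_preimage: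
  assumes "cp.subspace W"
  shows "cp.subspace {p. p * z \<in> W}"
  using assms unfolding cp.subspace_def by (auto simp: distrib_right scale_def mult.assoc)

lemma span_mult_mem:
  assumes "cp.subspace W" "\<And>x. x \<in> S \<Longrightarrow> x * z \<in> W" "p \<in> cp.span S"
  shows "p * z \<in> W"
  using cp.span_minimal[of S "{p. p * z \<in> W}"] subspace_mult_preimage[OF assms(1)] assms by blast

text \<open>If \<open>z\<^sup>d\<close> is a combination of smaller powers of \<open>z\<close> with coefficients in the subring \<open>W\<close>,
  then the powers of \<open>z\<close> below \<open>d\<close> generate the ring \<open>W[z]\<close> over \<open>W\<close>.\<close>

lemma mult_closed_extend:
  assumes L: "is_ideal L" and one: "1 \<in> M" and d: "0 < d"
    and W: "mult_closed (cp.span (M \<union> L))"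
    and z: "\<forall>a<d. u a \<in> cp.span (M \<union> L)" "z ^ d = (\<Sum>a<d. z ^ a * u a)"
  defines "W' \<equiv> cp.span (extend_basis M z d \<union> L)"
  shows "mult_closed W'" "cp.span (M \<union> L) \<subseteq> W'" "z \<in> W'"
proof -
  let ?W = "cp.span (M \<union> L)"
  have sW': "cp.subspace W'" unfolding W'_def by simp
  have LW': "l \<in> W'" if "l \<in> L" for l unfolding W'_def using that by (simp add: cp.span_base)
  have pw: "w * z ^ a \<in> W'" if "a < d" "w \<in> ?W" for a w
    using sW' _ that(2)
  proof (rule span_mult_mem)
    fix x assume "x \<in> M \<union> L"
    then show "x * z ^ a \<in> W'"
    proof
      assume "x \<in> M"
      then have "z ^ a * x \<in> extend_basis M z d" using that(1) by (auto simp: extend_basis_def)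
      then show ?thesis unfolding W'_def by (simp add: cp.span_base mult.commute)
    qed (simp add: LW' is_ideal_mult_right[OF L])
  qed
  have pw_d: "w * z ^ d \<in> W'" if "w \<in> ?W" for w
  proof -
    have "w * z ^ d = (\<Sum>a<d. (w * u a) * z ^ a)"
      unfolding z(2) by (simp add: sum_distrib_left algebra_simps)
    moreover have "w * u a \<in> ?W" if "a < d" for a
      using W z(1) that \<open>w \<in> ?W\<close> by (auto simp: mult_closed_def)
    ultimately show ?thesis using pw by (auto intro!: cp.subspace_sum[OF sW'])
  qed
  have zW': "p * z \<in> W'" if "p \<in> W'" for p
    using sW' _ that[unfolded W'_def]
  proof (rule span_mult_mem)
    fix x assume "x \<in> extend_basis M z d \<union> L"
    then show "x * z \<in> W'"
    proof
      assume "x \<in> extend_basis M z d"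
      then obtain a y where x: "x = z ^ a * y" "a < d" "y \<in> M" by (auto simp: extend_basis_def)
      then have "y \<in> ?W" by (simp add: cp.span_base)
      then have "y * z ^ Suc a \<in> W'"
        using pw[of "Suc a" y] pw_d[of y] x(2) by (cases "Suc a = d") auto
      then show ?thesis by (simp add: x(1) algebra_simps)
    qed (simp add: LW' is_ideal_mult_right[OF L])
  qed
  have zpW': "p * z ^ a \<in> W'" if "p \<in> W'" for p a
    using that by (induction a arbitrary: p) (simp_all add: zW' mult.assoc[symmetric])
  have wW': "p * w \<in> W'" if "p \<in> W'" "w \<in> ?W" for p w
    using sW' _ that(1)[unfolded W'_def]
  proof (rule span_mult_mem)
    fix x assume "x \<in> extend_basis M z d \<union> L"
    then show "x * w \<in> W'"
    proof
      assume "x \<in> extend_basis M z d"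
      then obtain a y where x: "x = z ^ a * y" "a < d" "y \<in> M" by (auto simp: extend_basis_def)
      then have "y * w \<in> ?W" using W that(2) by (simp add: cp.span_base mult_closed_def)
      then have "y * w * z ^ a \<in> W'" using pw[OF x(2)] by blast
      then show ?thesis by (simp add: x(1) algebra_simps)
    qed (simp add: LW' is_ideal_mult_right[OF L])
  qed
  show "mult_closed W'"
    unfolding mult_closed_def
  proof (intro ballI)
    fix p q assume "p \<in> W'" and q: "q \<in> W'"
    from sW' _ this(1)[unfolded W'_def] show "p * q \<in> W'"
    proof (rule span_mult_mem)
      fix x assume "x \<in> extend_basis M z d \<union> L"
      then show "x * q \<in> W'"
      proof
        assume "x \<in> extend_basis M z d"
        then obtain a y where x: "x = z ^ a * y" "a < d" "y \<in> M" by (auto simp: extend_basis_def)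
        then have "q * y * z ^ a \<in> W'" using wW' q zpW' by (simp add: cp.span_base)
        then show ?thesis by (simp add: x(1) algebra_simps)
      qed (simp add: LW' is_ideal_mult_right[OF L])
    qed
  qed
  show "?W \<subseteq> W'" using pw[OF d] by auto
  then have "1 \<in> W'" using one by (auto simp: cp.span_base)
  then show "z \<in> W'" using zW'[of 1] by simp
qed

section \<open>Elementary symmetric polynomials of a set of variables and Vieta's formula\<close>

definition esym :: "nat set \<Rightarrow> nat \<Rightarrow> cpoly"
  where "esym S j = (\<Sum>T | T \<subseteq> S \<and> card T = j. \<Prod>i\<in>T. var i)"

lemma elem_sym_eq: "elem_sym n j = esym {1..n} j"
  by (simp add: elem_sym_def esym_def)

lemma esym_zero:
  assumes "finite S"
  shows "esym S 0 = 1"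
proof -
  have "{T. T \<subseteq> S \<and> card T = 0} = {{}}"
    using finite_subset[OF _ assms] by auto
  then show ?thesis by (simp add: esym_def)
qed

lemma esym_gt_card:
  assumes "finite S" "card S < j"
  shows "esym S j = 0"
proof -
  have "{T. T \<subseteq> S \<and> card T = j} = {}"
    using assms(2) card_mono[OF assms(1)] by (auto dest: leD)
  then show ?thesis unfolding esym_def by (simp only: sum.empty)
qed

lemma esym_card:
  assumes "finite S"
  shows "esym S (card S) = (\<Prod>i\<in>S. var i)"
proof -
  have "{T. T \<subseteq> S \<and> card T = card S} = {S}"
    using card_subset_eq[OF assms] by blast
  then show ?thesis by (simp add: esym_def)
qed

lemma esym_insert:
  assumes "finite S" "x \<notin> S"
  shows "esym (insert x S) (Suc j) = esym S (Suc j) + var x * esym S j"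
proof -
  let ?A = "{T. T \<subseteq> S \<and> card T = Suc j}" and ?B = "{T. T \<subseteq> S \<and> card T = j}"
  have fin: "finite T" if "T \<subseteq> S" for T using that assms finite_subset by blast
  have eq: "{T. T \<subseteq> insert x S \<and> card T = Suc j} = ?A \<union> insert x ` ?B" (is "?L = _")
  proof (intro equalityI subsetI)
    fix T assume T: "T \<in> ?L"
    show "T \<in> ?A \<union> insert x ` ?B"
    proof (cases "x \<in> T")
      case True
      then have "T = insert x (T - {x})" "T - {x} \<subseteq> S" "card (T - {x}) = j"
        using T assms by (auto simp: card_Diff_singleton)
      then show ?thesis by blast
    qed (use T in auto)
  next
    fix T assume "T \<in> ?A \<union> insert x ` ?B"
    then show "T \<in> ?L"
    proof
      assume "T \<in> insert x ` ?B"
      then obtain U where U: "T = insert x U" "U \<subseteq> S" "card U = j" by blast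
      have "x \<notin> U" using U(2) assms(2) by blast
      then have "card T = Suc j" using fin[of U] U by simp
      then show ?thesis using U by auto
    qed auto
  qed
  have inj: "inj_on (insert x) ?B"
  proof (rule inj_onI)
    fix T U assume "T \<in> ?B" "U \<in> ?B" "insert x T = insert x U"
    then show "T = U" using assms(2) by (metis (lifting) Diff_insert_absorb in_mono mem_Collect_eq)
  qed
  have "esym (insert x S) (Suc j) = esym S (Suc j) + (\<Sum>T\<in>insert x ` ?B. \<Prod>i\<in>T. var i)"
    unfolding esym_def eq using assms by (intro sum.union_disjoint) auto
  also have "(\<Sum>T\<in>insert x ` ?B. \<Prod>i\<in>T. var i) = (\<Sum>T\<in>?B. \<Prod>i\<in>insert x T. var i)"
    using inj by (simp add: sum.reindex)
  also have "\<dots> = (\<Sum>T\<in>?B. var x * (\<Prod>i\<in>T. var i))"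
    using assms fin by (intro sum.cong refl prod.insert) auto
  finally show ?thesis by (simp add: esym_def sum_distrib_left)
qed

lemma esym_vieta:
  assumes "finite S"
  shows "(\<Sum>i\<le>card S. (- 1) ^ i * esym S i * y ^ (card S - i)) = (\<Prod>s\<in>S. y - var s)"
  using assms
proof induction
  case empty
  then show ?case by (simp add: esym_zero)
next
  case (insert x F)
  let ?n = "card F"
  have c: "card (insert x F) = Suc ?n" using insert by simp
  have "(\<Sum>i\<le>card (insert x F). (- 1) ^ i * esym (insert x F) i * y ^ (card (insert x F) - i)) =
      y ^ Suc ?n + (\<Sum>i\<le>?n. (- 1) ^ Suc i * esym (insert x F) (Suc i) * y ^ (?n - i))"
    unfolding c using insert by (simp add: sum.atMost_Suc_shift esym_zero del: sum.atMost_Suc)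
  also have "\<dots> = y ^ Suc ?n + (\<Sum>i\<le>?n. (- 1) ^ Suc i * esym F (Suc i) * y ^ (?n - i))
      - var x * (\<Sum>i\<le>?n. (- 1) ^ i * esym F i * y ^ (?n - i))"
  proof -
    have "(- 1) ^ Suc i * esym (insert x F) (Suc i) * y ^ (?n - i) =
        (- 1) ^ Suc i * esym F (Suc i) * y ^ (?n - i) -
        var x * ((- 1) ^ i * esym F i * y ^ (?n - i))" for i
      using insert by (simp add: esym_insert algebra_simps)
    then show ?thesis by (simp only: sum_subtractf sum_distrib_left add_diff_eq)
  qed
  also have "y ^ Suc ?n + (\<Sum>i\<le>?n. (- 1) ^ Suc i * esym F (Suc i) * y ^ (?n - i)) =
      (\<Sum>i\<le>Suc ?n. (- 1) ^ i * esym F i * y ^ (Suc ?n - i))"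
    using insert by (simp add: sum.atMost_Suc_shift esym_zero del: sum.atMost_Suc)
  \<comment> \<open>The last summand vanishes, since \<open>esym F\<close> is zero beyond
    \<open>card F\<close>; every other one contains a factor \<open>y\<close>.\<close>
  also have "\<dots> = y * (\<Sum>i\<le>?n. (- 1) ^ i * esym F i * y ^ (?n - i))"
    using insert.hyps by (simp add: esym_gt_card sum_distrib_left Suc_diff_le algebra_simps)
  finally show ?case
    by (simp only: insert.IH prod.insert[OF insert.hyps] left_diff_distrib)
qed

section \<open>Reduction modulo the leading forms and a variable\<close>

text \<open>The bound \<open>r i < i\<close> anticipates the tower: \<open>v i\<close> is a root of
  the Vieta polynomial of the i variables \<open>v 1\<close>, ..., \<open>v i\<close>.\<close>

definition box :: "(nat \<Rightarrow> cpoly) \<Rightarrow> nat \<Rightarrow> nat \<Rightarrow> cpoly set"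
  where "box v j n = {\<Prod>i\<in>{j<..n}. v i ^ r i |r. \<forall>i\<in>{j<..n}. r i < i}"

lemma extend_basis_box:
  assumes "j < n"
  shows "extend_basis (box v (Suc j) n) (v (Suc j)) (Suc j) \<subseteq> box v j n"
proof
  fix x assume "x \<in> extend_basis (box v (Suc j) n) (v (Suc j)) (Suc j)"
  then obtain a r where x: "x = v (Suc j) ^ a * (\<Prod>i\<in>{Suc j<..n}. v i ^ r i)" "a < Suc j"
      "\<forall>i\<in>{Suc j<..n}. r i < i"
    by (auto simp: extend_basis_def box_def)
  let ?r = "r(Suc j := a)"
  have "{j<..n} = insert (Suc j) {Suc j<..n}" using assms by auto
  moreover have "(\<Prod>i\<in>{Suc j<..n}. v i ^ ?r i) = (\<Prod>i\<in>{Suc j<..n}. v i ^ r i)"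
    by (rule prod.cong) auto
  ultimately have "x = (\<Prod>i\<in>{j<..n}. v i ^ ?r i)" "\<forall>i\<in>{j<..n}. ?r i < i"
    using x by auto
  then show "x \<in> box v j n" unfolding box_def by blast
qed

lemma one_extend_basis:
  assumes "1 \<in> M" "0 < d"
  shows "1 \<in> extend_basis M z d"
proof -
  have "1 = z ^ 0 * 1" by simp
  then show ?thesis using assms unfolding extend_basis_def by blast
qed

text \<open>\<open>omit_index N k\<close> enumerates \<open>{1..N} - {k}\<close> by \<open>{1..N - 1}\<close> so that \<open>N - 1\<close> is sent to \<open>1\<close> whenever
  \<open>k \<noteq> 1\<close>: the first leading form is \<open>e\<^sub>1 + c\<^sub>1\<close>, and with \<open>c\<^sub>1\<close> as first variable the tower starts
  with the equation \<open>2c\<^sub>1\<^sup>n = 0\<close>, \<open>n = N - 1\<close>. The variable with number \<open>i\<close> has degree \<open>i\<close> in the tower.\<close>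

definition omit_index :: "nat \<Rightarrow> nat \<Rightarrow> nat \<Rightarrow> nat"
  where "omit_index N k i = (if N - i = k then N else N - i)"

lemma omit_index_inj: "0 < k \<Longrightarrow> inj_on (omit_index N k) {1..<N}"
  by (auto simp: inj_on_def omit_index_def split: if_splits)

lemma omit_index_image:
  assumes "0 < k" "k < N"
  shows "omit_index N k ` {1..<N} = {1..N} - {k}"
proof
  show "{1..N} - {k} \<subseteq> omit_index N k ` {1..<N}"
  proof
    fix i assume i: "i \<in> {1..N} - {k}"
    show "i \<in> omit_index N k ` {1..<N}"
    proof (cases "i = N")
      case True
      then show ?thesis using assms by (intro image_eqI[of _ _ "N - k"]) (auto simp: omit_index_def)
    next
      case False
      then show ?thesis using i by (intro image_eqI[of _ _ "N - i"]) (auto simp: omit_index_def)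
    qed
  qed
qed (use assms in \<open>auto simp: omit_index_def\<close>)

text \<open>The leading forms of the generators. For i = 1 the term - (-1) c_1 has the same degree
  as e_1 and therefore stays.\<close>

definition top_form :: "nat \<Rightarrow> nat \<Rightarrow> cpoly"
  where "top_form N i = (if i < N then elem_sym N i + (if i = 1 then var 1 else 0)
    else (\<Prod>j\<in>{1..<N}. var j))"

text \<open>Vieta's product vanishes at each of its roots; the identity is solved for the top power
  to serve as the monic relation in \<open>mult_closed_extend\<close>.\<close>

lemma vieta_root:
  assumes "finite S" "s \<in> S"
  shows "var s ^ card S = (\<Sum>a<card S. var s ^ a * (- ((- 1) ^ (card S - a) * esym S (card S - a))))"
proof -
  let ?n = "card S" and ?f = "\<lambda>i. (- 1) ^ i * esym S i * var s ^ (card S - i)"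
  have "(\<Sum>i\<le>?n. ?f i) = 0"
    using esym_vieta[OF assms(1), of "var s"] assms by (auto intro!: prod_zero)
  \<comment> \<open>The order of summation is reversed, so that the index becomes the exponent of
    \<open>var s\<close>.\<close>
  moreover have "(\<Sum>i\<le>?n. ?f i) = (\<Sum>a\<le>?n. ?f (?n - a))"
    by (rule sum.nat_diff_reindex[symmetric, where 'a=cpoly, of _ "Suc (card S)",
        unfolded lessThan_Suc_atMost, simplified])
  moreover have "(\<Sum>a\<le>?n. ?f (?n - a)) = (\<Sum>a<?n. ?f (?n - a)) + var s ^ ?n"
    using assms by (simp add: lessThan_Suc_atMost[symmetric] esym_zero)
  moreover have "(\<Sum>a<?n. ?f (?n - a)) =
      (\<Sum>a<?n. - (var s ^ a * (- ((- 1) ^ (?n - a) * esym S (?n - a)))))"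
    by (intro sum.cong) auto
  ultimately show ?thesis by (simp add: sum_negf eq_neg_iff_add_eq_0 add.commute)
qed

section \<open>The tower of monic equations modulo the leading forms and c_k\<close>

context
  fixes N k :: nat and L :: "cpoly set"
  assumes N: "2 \<le> N" and k: "0 < k" "k < N" and L: "is_ideal L"
    and top: "\<And>i. i \<in> {1..<N} \<Longrightarrow> top_form N i \<in> L"
    and var_k: "var k \<in> L" and out: "\<And>i. i \<notin> {1..N} \<Longrightarrow> var i \<in> L"
begin

abbreviation (input) omit_set where "omit_set j \<equiv> omit_index N k ` {1..j}"

lemma card_omit_set:
  assumes "j < N"
  shows "finite (omit_set j)" "card (omit_set j) = j"
proof -
  have "{1..j} \<subseteq> {1..<N}" using assms by auto
  then have "inj_on (omit_index N k) {1..j}" by (rule inj_on_subset[OF omit_index_inj[OF k(1)]])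
  then show "card (omit_set j) = j" by (simp add: card_image)
qed simp

lemma omit_set_full: "omit_set (N - 1) = {1..N} - {k}"
proof -
  have "{1..N - 1} = {1..<N}" using N by auto
  then show ?thesis using omit_index_image[OF k] by simp
qed

lemma omit_set_Suc:
  assumes "Suc j < N"
  shows "omit_set (Suc j) = insert (omit_index N k (Suc j)) (omit_set j)" "omit_index N k (Suc j) \<notin> omit_set j"
proof -
  show "omit_set (Suc j) = insert (omit_index N k (Suc j)) (omit_set j)"
    by (simp add: atLeastAtMostSuc_conv)
  show "omit_index N k (Suc j) \<notin> omit_set j"
  proof
    assume "omit_index N k (Suc j) \<in> omit_set j"
    then obtain i where "i \<in> {1..j}" "omit_index N k i = omit_index N k (Suc j)" by auto
    then show False using inj_onD[OF omit_index_inj[OF k(1), of N], of i "Suc j"] assms by auto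
  qed
qed

text \<open>Since c_k is in \<open>L\<close>, omitting it does not change the elementary symmetric
  polynomials modulo \<open>L\<close>. The leading forms then make all of them vanish in positive
  degree except the one of degree 1, which becomes - c_1; in degree N only N - 1 variables are
  left.\<close>

lemma esym_full:
  assumes "i < N"
  shows "esym (omit_set (N - 1)) (Suc i) - (if i = 0 then - var 1 else 0) \<in> L"
proof -
  let ?S = "omit_set (N - 1)"
  have "{1..N} = insert k ?S" "k \<notin> ?S" "finite ?S" unfolding omit_set_full using k by auto
  then have e: "elem_sym N (Suc i) = esym ?S (Suc i) + var k * esym ?S i"
    by (simp add: elem_sym_eq esym_insert)
  show ?thesis
  proof (cases "Suc i = N")
    case True
    then have "esym ?S (Suc i) = 0" using card_omit_set[of "N - 1"] N by (intro esym_gt_card) auto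
    then show ?thesis using N True L by (simp add: is_ideal_zero)
  next
    case False
    then have "top_form N (Suc i) - var k * esym ?S i \<in> L"
      using assms by (intro is_ideal_diff[OF L] top is_ideal_mult_right[OF L var_k]) auto
    moreover have "top_form N (Suc i) - var k * esym ?S i =
        esym ?S (Suc i) - (if i = 0 then - var 1 else 0)"
      using False assms by (simp add: top_form_def e)
    ultimately show ?thesis by simp
  qed
qed

text \<open>By \<open>esym_full\<close>, Vieta's relation collapses to z^n + c_1 z^{n-1} modulo
  \<open>L\<close>. For k = 1 the second term is in \<open>L\<close>; otherwise the enumeration
  gives z = c_1 and the relation is 2 z^n, where 2 is invertible.\<close>

lemma first_power_in_ideal: "var (omit_index N k (N - 1)) ^ (N - 1) \<in> L"
proof -
  let ?n = "N - 1" and ?S = "omit_set (N - 1)"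
  define z where "z = var (omit_index N k (N - 1))"
  have n: "0 < ?n" "N = Suc ?n" using N by auto
  have S: "finite ?S" "card ?S = ?n" using card_omit_set[of ?n] N by auto
  define u where "u a = z ^ a * (- ((- 1) ^ (?n - a) * esym ?S (?n - a)))" for a
  have "z ^ ?n = (\<Sum>a<?n. u a)"
    using vieta_root[OF S(1), of "omit_index N k ?n"] n unfolding S z_def u_def by auto
  also have "\<dots> = (\<Sum>a\<in>{..<?n - 1}. u a) + u (?n - 1)"
    using n(1) by (metis Suc_pred' sum.lessThan_Suc)
  finally have "z ^ ?n - u (?n - 1) = (\<Sum>a\<in>{..<?n - 1}. u a)" by simp
  also have "\<dots> \<in> L"
  proof (rule is_ideal_sum[OF L])
    fix a assume "a \<in> {..<?n - 1}"
    then have "esym ?S (?n - a) \<in> L"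
      using esym_full[of "?n - a - 1"] by (auto split: if_splits simp: Suc_diff_Suc)
    then show "u a \<in> L" unfolding u_def using L by (intro is_ideal_mult is_ideal_minus) auto
  qed
  finally have 1: "z ^ ?n - u (?n - 1) \<in> L" .
  have "u (?n - 1) = z ^ (?n - 1) * esym ?S 1"
    unfolding u_def using n(1) by simp
  moreover have "z ^ (?n - 1) * (esym ?S 1 + var 1) \<in> L"
    using esym_full[of 0] N L by (intro is_ideal_mult) auto
  ultimately have 2: "z ^ ?n + z ^ (?n - 1) * var 1 \<in> L"
    using is_ideal_add[OF L 1, of "z ^ (?n - 1) * (esym ?S 1 + var 1)"] by (simp add: algebra_simps)
  show ?thesis
  proof (cases "k = 1")
    case True
    then have "z ^ (?n - 1) * var 1 \<in> L" using var_k L by (auto intro: is_ideal_mult)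
    from is_ideal_diff[OF L 2 this] show ?thesis by (simp add: z_def)
  next
    case False
    then have "z = var 1" using N by (simp add: z_def omit_index_def)
    then have "z ^ ?n + z ^ ?n \<in> L" using 2 n(1) by (metis Suc_pred' mult.commute power_Suc)
    then have "scale (1 / 2) (z ^ ?n + z ^ ?n) \<in> L" using L by (simp add: is_ideal_scale)
    moreover have "scale (1 / 2) (z ^ ?n + z ^ ?n) = z ^ ?n"
      by (simp only: cp.scale_right_distrib flip: cp.scale_left_distrib) simp
    ultimately show ?thesis by (simp add: z_def)
  qed
qed

lemma span_one_closed: "mult_closed (cp.span ({1} \<union> L))"
  unfolding mult_closed_def
proof (intro ballI)
  fix p q assume p: "p \<in> cp.span ({1} \<union> L)" and q: "q \<in> cp.span ({1} \<union> L)"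
  show "p * q \<in> cp.span ({1} \<union> L)"
    by (rule span_mult_mem[OF _ _ p])
      (use q L in \<open>auto simp: is_ideal_mult_right intro: cp.span_base\<close>)
qed

text \<open>Induction downwards in j: variable number j + 1 is a root of a monic equation of degree
  j + 1 whose coefficients are symmetric in the variables numbered 1 to j + 1. The induction
  therefore carries along that these symmetric polynomials lie in the multiplicatively closed
  span.\<close>

lemma tower:
  assumes "j < N - 1"
  shows "\<exists>M \<subseteq> box (\<lambda>i. var (omit_index N k i)) j (N - 1). 1 \<in> M \<and> mult_closed (cp.span (M \<union> L)) \<and>
    (\<forall>i. esym (omit_set j) i \<in> cp.span (M \<union> L)) \<and> (\<forall>i\<in>{j<..N - 1}. var (omit_index N k i) \<in> cp.span (M \<union> L))"
  using assms
proof (induction "N - 2 - j" arbitrary: j)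
  case 0
  let ?n = "N - 1" and ?v = "\<lambda>i. var (omit_index N k i)"
  have j: "Suc j = ?n" using 0 N by auto
  define M where "M = extend_basis {1} (?v ?n) ?n"
  let ?W = "cp.span (M \<union> L)"
  \<comment> \<open>The power itself is in \<open>L\<close>, so it can serve as the constant
    coefficient of its own relation.\<close>
  define u where "u a = (if a = 0 then ?v ?n ^ ?n else 0)" for a :: nat
  have u: "\<forall>a<?n. u a \<in> cp.span ({1} \<union> L)"
    using first_power_in_ideal by (auto simp: u_def cp.span_base cp.span_zero)
  have z: "?v ?n ^ ?n = (\<Sum>a<?n. ?v ?n ^ a * u a)"
    using j by (simp add: u_def if_distrib[of "\<lambda>x. _ * x"] sum.delta cong: if_cong)
  note ext = mult_closed_extend[OF L _ _ span_one_closed u z, folded M_def, simplified]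
  have "{1} \<subseteq> box ?v ?n ?n" by (auto simp: box_def)
  then have "M \<subseteq> extend_basis (box ?v ?n ?n) (?v ?n) ?n"
    unfolding M_def extend_basis_def by blast
  also have "\<dots> \<subseteq> box ?v j ?n" using extend_basis_box[of j ?n ?v] j by simp
  finally have M: "M \<subseteq> box ?v j ?n" .
  have W: "mult_closed ?W" "?v ?n \<in> ?W" using ext j by auto
  have one: "1 \<in> M" using j unfolding M_def by (intro one_extend_basis) auto
  have LW: "l \<in> ?W" if "l \<in> L" for l using that by (simp add: cp.span_base)
  \<comment> \<open>The nonzero coefficient - c_1 in \<open>esym_full\<close> must be in the span
    too; it is, because c_1 is either the omitted variable or the one just adjoined.\<close>
  have v1: "var 1 \<in> ?W"
  proof (cases "k = 1")
    case True then show ?thesis using var_k LW by simp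
  next
    case False
    then have "omit_index N k ?n = 1" using N by (simp add: omit_index_def)
    then show ?thesis using W(2) by simp
  qed
  have full: "esym (omit_set ?n) i \<in> ?W" for i
  proof (cases "i = 0 \<or> ?n < i")
    case True
    then show ?thesis
      using card_omit_set[of ?n] N one esym_zero[of "omit_set ?n"] esym_gt_card[of "omit_set ?n" i]
      by (auto simp: cp.span_base cp.span_zero)
  next
    case False
    then have "esym (omit_set ?n) i - (if i - 1 = 0 then - var 1 else 0) \<in> ?W"
      using esym_full[of "i - 1"] by (intro LW) auto
    moreover have "(if i - 1 = 0 then - var 1 else 0) \<in> ?W"
      using v1 by (simp add: cp.span_neg cp.span_zero)
    ultimately show ?thesis using cp.span_add by fastforce
  qed
  \<comment> \<open>Dividing the Vieta polynomial by the linear factor of the adjoined variable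
    expresses the symmetric polynomials of the remaining variables recursively.\<close>
  have "esym (omit_set j) i \<in> ?W" for i
  proof (induction i)
    case 0
    have "esym (omit_set j) 0 = 1" using card_omit_set[of j] j by (intro esym_zero) auto
    then show ?case using one by (simp add: cp.span_base)
  next
    case (Suc i)
    have "esym (omit_set ?n) (Suc i) = esym (omit_set j) (Suc i) + ?v ?n * esym (omit_set j) i"
      using omit_set_Suc[of j] card_omit_set[of j] j N esym_insert[of "omit_set j" "omit_index N k ?n"] by auto
    then have "esym (omit_set j) (Suc i) = esym (omit_set ?n) (Suc i) - ?v ?n * esym (omit_set j) i" by simp
    moreover have "?v ?n * esym (omit_set j) i \<in> ?W" using Suc W by (auto simp: mult_closed_def)
    ultimately show ?case using full by (simp only: cp.span_diff)
  qed
  moreover have "\<forall>i\<in>{j<..?n}. ?v i \<in> ?W"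
  proof
    fix i assume "i \<in> {j<..?n}"
    then have "i = ?n" using j by auto
    then show "?v i \<in> ?W" using W(2) by simp
  qed
  ultimately show ?case using M one W by blast
next
  case (Suc x)
  let ?n = "N - 1" and ?v = "\<lambda>i. var (omit_index N k i)" and ?z = "var (omit_index N k (Suc j))"
  have sj: "Suc j < ?n" "x = N - 2 - Suc j" using Suc by auto
  from Suc(1)[OF sj(2) sj(1)] obtain M where M: "M \<subseteq> box ?v (Suc j) ?n" "1 \<in> M"
      "mult_closed (cp.span (M \<union> L))" "\<And>i. esym (omit_set (Suc j)) i \<in> cp.span (M \<union> L)"
      "\<And>i. i \<in> {Suc j<..?n} \<Longrightarrow> ?v i \<in> cp.span (M \<union> L)"
    by blast
  define M' where "M' = extend_basis M ?z (Suc j)"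
  let ?W = "cp.span (M \<union> L)" and ?W' = "cp.span (M' \<union> L)"
  have S: "finite (omit_set (Suc j))" "card (omit_set (Suc j)) = Suc j" using card_omit_set[of "Suc j"] sj by auto
  define u where "u a = - ((- 1) ^ (Suc j - a) * esym (omit_set (Suc j)) (Suc j - a))" for a
  have z: "?z ^ Suc j = (\<Sum>a<Suc j. ?z ^ a * u a)"
    using vieta_root[OF S(1), of "omit_index N k (Suc j)"] unfolding S(2) u_def by auto
  have u: "\<forall>a<Suc j. u a \<in> ?W"
  proof (intro allI impI)
    fix a
    have "(- 1) ^ (Suc j - a) * esym (omit_set (Suc j)) (Suc j - a) \<in> ?W"
      using M(4) cp.span_neg by (cases "even (Suc j - a)") auto
    then show "u a \<in> ?W" unfolding u_def by (rule cp.span_neg)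
  qed
  have W': "mult_closed ?W'" "?W \<subseteq> ?W'" "?z \<in> ?W'"
    using mult_closed_extend[OF L M(2) _ M(3) u z, folded M'_def] by auto
  have M': "M' \<subseteq> box ?v j ?n"
  proof -
    have "M' \<subseteq> extend_basis (box ?v (Suc j) ?n) ?z (Suc j)"
      using M(1) unfolding M'_def extend_basis_def by blast
    then show ?thesis using extend_basis_box[of j ?n ?v] sj by auto
  qed
  have one: "1 \<in> M'" using M(2) unfolding M'_def by (simp add: one_extend_basis)
  have "esym (omit_set j) i \<in> ?W'" for i
  proof (induction i)
    case 0
    have "esym (omit_set j) 0 = 1" using card_omit_set[of j] sj by (intro esym_zero) auto
    then show ?case using one by (simp add: cp.span_base)
  next
    case (Suc i)
    have "esym (omit_set (Suc j)) (Suc i) = esym (omit_set j) (Suc i) + ?z * esym (omit_set j) i"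
      using omit_set_Suc[of j] card_omit_set[of j] sj esym_insert[of "omit_set j" "omit_index N k (Suc j)"] by auto
    then have "esym (omit_set j) (Suc i) = esym (omit_set (Suc j)) (Suc i) - ?z * esym (omit_set j) i" by simp
    moreover have "?z * esym (omit_set j) i \<in> ?W'" using Suc W' by (auto simp: mult_closed_def)
    moreover have "esym (omit_set (Suc j)) (Suc i) \<in> ?W'" using M(4) W'(2) by blast
    ultimately show ?case by (simp only: cp.span_diff)
  qed
  moreover have "\<forall>i\<in>{j<..?n}. ?v i \<in> ?W'"
  proof
    fix i assume "i \<in> {j<..?n}"
    then have "i = Suc j \<or> i \<in> {Suc j<..?n}" by auto
    then show "?v i \<in> ?W'" using W' M(5) by blast
  qed
  ultimately show ?case using M' one W' by blast
qed

lemma box_spans: "cp.span (box (\<lambda>i. var (omit_index N k i)) 0 (N - 1) \<union> L) = UNIV"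
proof -
  let ?n = "N - 1" and ?v = "\<lambda>i. var (omit_index N k i)"
  obtain M where M: "M \<subseteq> box ?v 0 ?n" "1 \<in> M" "mult_closed (cp.span (M \<union> L))"
      "\<And>i. i \<in> {0<..?n} \<Longrightarrow> ?v i \<in> cp.span (M \<union> L)"
    using tower[of 0] N by auto
  have "p \<in> cp.span (M \<union> L)" for p
  proof (rule cpoly_generated[where T = "cp.span (M \<union> L)"])
    fix c
    have "scale c 1 \<in> cp.span (M \<union> L)" using M(2) by (simp add: cp.span_base cp.span_scale)
    then show "Const c \<in> cp.span (M \<union> L)" by (simp add: scale_def)
  next
    fix i
    show "var i \<in> cp.span (M \<union> L)"
    proof (cases "i \<in> {1..N} \<and> i \<noteq> k")
      case True
      then have "i \<in> omit_index N k ` {1..<N}" using omit_index_image[OF k] by blast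
      then show ?thesis using M(4) by auto
    next
      case False
      then show ?thesis using var_k out by (auto simp: cp.span_base)
    qed
  qed (use M(3) in \<open>auto simp: mult_closed_def cp.span_add\<close>)
  moreover have "cp.span (M \<union> L) \<subseteq> cp.span (box ?v 0 ?n \<union> L)"
    using M(1) by (intro cp.span_mono) auto
  ultimately show ?thesis by blast
qed

end

section \<open>Spanning modulo the leading forms\<close>

text \<open>A filtration by the ideals of the products c_1...c_k: each layer is generated by
  c_1...c_k over the quotient modulo c_{k+1}, which a box of at most (N - 1)! monomials spans. There
  are N - 1 layers.\<close>

definition basis_set :: "nat \<Rightarrow> cpoly set"
  where "basis_set N = {(\<Prod>i\<in>{1..k}. var i) * x |k x.
    k < N - 1 \<and> x \<in> box (\<lambda>i. var (omit_index N (Suc k) i)) 0 (N - 1)}"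

text \<open>The last top form \<open>c\<^sub>1\<cdots>c\<^bsub>N-1\<^esub>\<close> is split off one linear factor at a time: modulo the
  ideal and \<open>c\<^bsub>k+1\<^esub>\<close> a box of monomials suffices.\<close>

lemma basis_set_spans:
  assumes N: "2 \<le> N" and J: "is_ideal J" and top: "\<And>i. i \<in> {1..N} \<Longrightarrow> top_form N i \<in> J"
    and out: "\<And>i. i \<notin> {1..N} \<Longrightarrow> var i \<in> J"
  shows "cp.span (basis_set N \<union> J) = UNIV"
proof -
  let ?P = "\<lambda>k. \<Prod>i\<in>{1..k}. var i"
  let ?W = "\<lambda>k. cp.span (basis_set N \<union> adjoin J (?P k))"
  \<comment> \<open>For k = 0 the adjoined product is empty, so the ideal is everything; for k = N -
    1 it is the last leading form, already in \<open>J\<close>. The induction leads from the trivial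
    end to the wanted one.\<close>
  have "k \<le> N - 1 \<Longrightarrow> ?W k = UNIV" for k
  proof (induction k)
    case 0
    have "p = 0 + 1 * p" for p :: cpoly by simp
    then have "adjoin J 1 = UNIV" using is_ideal_zero[OF J] unfolding adjoin_def by blast
    then show ?case by simp
  next
    case (Suc k)
    let ?B = "box (\<lambda>i. var (omit_index N (Suc k) i)) 0 (N - 1)"
    let ?L = "adjoin J (var (Suc k))"
    have L: "is_ideal ?L" by (rule is_ideal_adjoin[OF J])
    have full: "cp.span (?B \<union> ?L) = UNIV"
    proof (rule box_spans[OF N _ _ L])
      show "top_form N i \<in> ?L" if "i \<in> {1..<N}" for i
        using top[of i] that adjoin_incl by auto
      show "var (Suc k) \<in> ?L" by (rule adjoin_self[OF J])
      show "var i \<in> ?L" if "i \<notin> {1..N}" for i using out that adjoin_incl by blast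
    qed (use Suc in auto)
    have PS: "?P (Suc k) = var (Suc k) * ?P k" by (simp add: atLeastAtMostSuc_conv)
    have "h * ?P k \<in> ?W (Suc k)" for h
    proof (rule span_mult_mem)
      show "h \<in> cp.span (?B \<union> ?L)" unfolding full ..
      fix x assume "x \<in> ?B \<union> ?L"
      then show "x * ?P k \<in> ?W (Suc k)"
      proof
        assume "x \<in> ?B"
        moreover have "k < N - 1" using Suc.prems by simp
        ultimately have "?P k * x \<in> basis_set N" unfolding basis_set_def by blast
        then show ?thesis by (simp add: cp.span_base mult.commute)
      next
        assume "x \<in> ?L"
        then obtain l g where "x = l + var (Suc k) * g" "l \<in> J" by (auto simp: adjoin_def)
        then have "x * ?P k = l * ?P k + ?P (Suc k) * g" "l * ?P k \<in> J"
          unfolding PS using J by (simp_all add: algebra_simps is_ideal_mult_right)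
        then have "x * ?P k \<in> adjoin J (?P (Suc k))" unfolding adjoin_def by blast
        then show ?thesis by (simp add: cp.span_base)
      qed
    qed simp
    moreover have "l \<in> ?W (Suc k)" if "l \<in> J" for l
      using that adjoin_incl[of J] by (meson UnI2 cp.span_base subsetD)
    ultimately have "adjoin J (?P k) \<subseteq> ?W (Suc k)"
      unfolding adjoin_def[of J "?P k"] by (auto simp: cp.span_add mult.commute)
    moreover have "basis_set N \<subseteq> ?W (Suc k)" by (meson Un_upper1 cp.span_superset order_trans)
    ultimately have "?W k \<subseteq> ?W (Suc k)" by (intro cp.span_minimal) auto
    then show ?case using Suc by auto
  qed
  then have "?W (N - 1) = UNIV" by simp
  moreover have "?P (N - 1) = top_form N N"
  proof -
    have "{1..N - 1} = {1..<N}" using N by auto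
    then show ?thesis by (simp add: top_form_def)
  qed
  then have "?P (N - 1) \<in> J" using top[of N] N by simp
  then have "adjoin J (?P (N - 1)) \<subseteq> J"
    using J unfolding adjoin_def by (auto simp: is_ideal_add is_ideal_mult_right)
  then have "?W (N - 1) \<subseteq> cp.span (basis_set N \<union> J)" by (intro cp.span_mono) auto
  ultimately show ?thesis by auto
qed

section \<open>Homogeneous polynomials, degree bounds and leading forms\<close>

definition homog :: "nat set \<Rightarrow> nat \<Rightarrow> cpoly \<Rightarrow> bool"
  where "homog A d p \<longleftrightarrow> (\<forall>m\<in>Poly_Mapping.keys p. Poly_Mapping.keys m \<subseteq> A \<and> monom_degree m = d)"

definition deg_less :: "nat set \<Rightarrow> nat \<Rightarrow> cpoly \<Rightarrow> bool"
  where "deg_less A d p \<longleftrightarrow> (\<forall>m\<in>Poly_Mapping.keys p. Poly_Mapping.keys m \<subseteq> A \<and> monom_degree m < d)"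

lemma keys_multD:
  fixes p q :: cpoly
  assumes "m \<in> Poly_Mapping.keys (p * q)"
  obtains a b where "a \<in> Poly_Mapping.keys p" "b \<in> Poly_Mapping.keys q" "m = a + b"
  using assms Poly_Mapping.keys_mult[of p q] by blast

lemma homog_mult: "homog A d p \<Longrightarrow> homog A d' q \<Longrightarrow> homog A (d + d') (p * q)"
  unfolding homog_def by (fastforce elim!: keys_multD simp: keys_add_monom monom_degree_add)

text \<open>One weak and one strict bound: this fits a coefficient of known degree times the lower
  terms of a generator.\<close>

lemma deg_less_mult: "deg_less A (Suc d) p \<Longrightarrow> deg_less A d' q \<Longrightarrow> deg_less A (d + d') (p * q)"
  unfolding deg_less_def
  by (fastforce elim!: keys_multD
      simp: keys_add_monom monom_degree_add less_Suc_eq_le add_le_less_mono)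

lemma homog_add: "homog A d p \<Longrightarrow> homog A d q \<Longrightarrow> homog A d (p + q)"
  unfolding homog_def using Poly_Mapping.keys_add[of p q] by blast

lemma deg_less_add: "deg_less A d p \<Longrightarrow> deg_less A d q \<Longrightarrow> deg_less A d (p + q)"
  unfolding deg_less_def using Poly_Mapping.keys_add[of p q] by blast

lemma deg_less_uminus [simp]: "deg_less A d (- p) \<longleftrightarrow> deg_less A d p"
  by (simp add: deg_less_def in_keys_iff)

lemma deg_less_diff: "deg_less A d p \<Longrightarrow> deg_less A d q \<Longrightarrow> deg_less A d (p - q)"
  using deg_less_add[of A d p "- q"] by simp

lemma deg_less_zero [simp]: "deg_less A d 0"
  by (simp add: deg_less_def)

lemma homog_one: "homog A 0 1" and deg_less_one: "0 < d \<Longrightarrow> deg_less A d 1"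
  by (simp_all add: homog_def deg_less_def flip: single_one)

lemma homog_var: "i \<in> A \<Longrightarrow> homog A 1 (var i)"
  by (simp add: homog_def var_def)

lemma homog_sum: "(\<And>i. i \<in> S \<Longrightarrow> homog A d (f i)) \<Longrightarrow> homog A d (sum f S)"
  by (induction S rule: infinite_finite_induct) (auto simp: homog_add homog_def[of _ _ 0])

lemma homog_prod: "(\<And>i. i \<in> S \<Longrightarrow> homog A (d i) (f i)) \<Longrightarrow> homog A (sum d S) (prod f S)"
  by (induction S rule: infinite_finite_induct) (auto simp: homog_one homog_mult)

lemma homog_power: "homog A d p \<Longrightarrow> homog A (d * n) (p ^ n)"
  by (induction n) (auto simp: homog_one homog_mult)

lemma deg_less_prod: "(\<And>i. i \<in> S \<Longrightarrow> deg_less A (Suc (d i)) (f i)) \<Longrightarrow> deg_less A (Suc (sum d S)) (prod f S)"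
proof (induction S rule: infinite_finite_induct)
  case (insert x F)
  then have "deg_less A (d x + Suc (sum d F)) (f x * prod f F)" by (intro deg_less_mult) auto
  with insert show ?case by simp
qed (auto simp: deg_less_one)

lemma deg_less_power: "deg_less A (Suc d) p \<Longrightarrow> deg_less A (Suc (d * n)) (p ^ n)"
proof (induction n)
  case (Suc n)
  then have "deg_less A (d + Suc (d * n)) (p * p ^ n)" by (intro deg_less_mult) auto
  then show ?case by simp
qed (auto simp: deg_less_one)

lemma homog_imp_deg_less: "homog A d p \<Longrightarrow> d < d' \<Longrightarrow> deg_less A d' p"
  by (auto simp: homog_def deg_less_def)

lemma deg_less_mono: "deg_less A d p \<Longrightarrow> d \<le> d' \<Longrightarrow> deg_less A d' p"
  by (fastforce simp: deg_less_def)

lemma homog_esym: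
  assumes "S \<subseteq> A"
  shows "homog A j (esym S j)"
  unfolding esym_def
proof (rule homog_sum)
  fix T assume "T \<in> {T. T \<subseteq> S \<and> card T = j}"
  then have T: "T \<subseteq> A" "card T = j" using assms by auto
  then have "homog A (\<Sum>i\<in>T. 1) (\<Prod>i\<in>T. var i)" by (intro homog_prod homog_var) auto
  with T show "homog A j (\<Prod>i\<in>T. var i)" by simp
qed

definition gen :: "nat \<Rightarrow> nat \<Rightarrow> cpoly"
  where "gen N i = (if i < N then alpha N i else alpha_tilde N)"

definition gen_degree :: "nat \<Rightarrow> nat \<Rightarrow> nat"
  where "gen_degree N i = (if i < N then i else N - 1)"

lemma gen_degree_pos: "2 \<le> N \<Longrightarrow> i \<in> {1..N} \<Longrightarrow> 0 < gen_degree N i"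
  by (auto simp: gen_degree_def)

lemma homog_top_form:
  assumes "2 \<le> N" "i \<in> {1..N}"
  shows "homog {1..N} (gen_degree N i) (top_form N i)"
proof (cases "i < N")
  case True
  then show ?thesis
    using assms by (auto simp: top_form_def gen_degree_def elem_sym_eq
        intro!: homog_add homog_esym homog_var[simplified])
next
  case False
  have "homog {1..N} (\<Sum>j\<in>{1..<N}. 1) (\<Prod>j\<in>{1..<N}. var j)"
    using assms by (intro homog_prod homog_var) auto
  then show ?thesis using False by (simp add: top_form_def gen_degree_def)
qed

lemma deg_less_gen_top_form:
  assumes "2 \<le> N" "i \<in> {1..N}"
  shows "deg_less {1..N} (gen_degree N i) (top_form N i - gen N i)"
proof (cases "i < N")
  case True
  then show ?thesis
  proof (cases "i = 1")
    case False
    have "deg_less {1..N} i (var i)" using homog_imp_deg_less[OF homog_var, of i "{1..N}" i] assms False by auto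
    then have "deg_less {1..N} i ((- 1) ^ i * var i)" by (cases "even i") auto
    then show ?thesis using True False by (simp add: top_form_def gen_degree_def gen_def alpha_def)
  qed (simp add: top_form_def gen_degree_def gen_def alpha_def)
next
  case False
  have "elem_sym (N - 1) (N - 1) = (\<Prod>i\<in>{1..N - 1}. var i)"
    using esym_card[of "{1..N - 1}"] by (simp add: elem_sym_eq)
  moreover have "{1..N - 1} = {1..<N}" using assms by auto
  moreover have "deg_less {1..N} (N - 1) ((- 1) ^ N)"
    using assms by (cases "even N") (auto simp: deg_less_one)
  ultimately show ?thesis using False by (simp add: top_form_def gen_degree_def gen_def alpha_tilde_def)
qed

lemma deg_less_gen:
  assumes "2 \<le> N" "i \<in> {1..N}"
  shows "deg_less {1..N} (Suc (gen_degree N i)) (gen N i)"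
  using deg_less_diff[OF homog_imp_deg_less[OF homog_top_form[OF assms], of "Suc (gen_degree N i)"]
      deg_less_mono[OF deg_less_gen_top_form[OF assms], of "Suc (gen_degree N i)"]] by simp

section \<open>A basis indexed by monomials\<close>

definition exps :: "nat \<Rightarrow> monom set"
  where "exps N = {e. Poly_Mapping.keys e \<subseteq> {1..N}}"

definition reduced_exps :: "nat \<Rightarrow> monom set"
  where "reduced_exps N = {e \<in> exps N. \<forall>i\<in>{1..N}. Poly_Mapping.lookup e i < gen_degree N i}"

text \<open>In \<open>beta N e\<close>, division of \<open>e\<^sub>i\<close> by \<open>d\<^sub>i\<close> gives the exponent of the \<open>i\<close>-th generator, and the
  remainders select a monomial of the spanning family. So the family has the same index set, with the same
  degrees, as the monomials of the polynomial ring.\<close>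

definition basis_monom :: "nat \<Rightarrow> monom \<Rightarrow> cpoly"
  where "basis_monom N e = (\<Prod>i\<in>{1..Poly_Mapping.lookup e N mod (N - 1)}. var i) *
    (\<Prod>i\<in>{0<..N - 1}. var (omit_index N (Suc (Poly_Mapping.lookup e N mod (N - 1))) i) ^
      (Poly_Mapping.lookup e i mod i))"

definition beta :: "nat \<Rightarrow> monom \<Rightarrow> cpoly"
  where "beta N e = basis_monom N e * (\<Prod>i\<in>{1..N}. gen N i ^ (Poly_Mapping.lookup e i div gen_degree N i))"

definition monom_of :: "nat \<Rightarrow> (nat \<Rightarrow> nat) \<Rightarrow> monom"
  where "monom_of N f = (\<Sum>i\<in>{1..N}. Poly_Mapping.single i (f i))"

lemma lookup_monom_of: "Poly_Mapping.lookup (monom_of N f) i = (if i \<in> {1..N} then f i else 0)"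
  by (simp add: monom_of_def lookup_sum lookup_single when_def)

lemma monom_of_exps: "monom_of N f \<in> exps N"
  by (auto simp: exps_def in_keys_iff lookup_monom_of split: if_splits)

lemma exps_eqI:
  assumes "e \<in> exps N" "e' \<in> exps N"
    and "\<And>i. i \<in> {1..N} \<Longrightarrow> Poly_Mapping.lookup e i = Poly_Mapping.lookup e' i"
  shows "e = e'"
proof (rule poly_mapping_eqI)
  fix i
  show "Poly_Mapping.lookup e i = Poly_Mapping.lookup e' i"
  proof (cases "i \<in> {1..N}")
    case False
    then have "i \<notin> Poly_Mapping.keys e" "i \<notin> Poly_Mapping.keys e'"
      using assms by (auto simp: exps_def)
    then show ?thesis by (simp add: in_keys_iff)
  qed (rule assms(3))
qed

lemma monom_degree_exps: "e \<in> exps N \<Longrightarrow> monom_degree e = (\<Sum>i\<in>{1..N}. Poly_Mapping.lookup e i)"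
  unfolding exps_def by (rule monom_degree_superset) auto

lemma finite_exps: "finite {e \<in> exps N. monom_degree e < m}"
proof (rule finite_subset)
  show "{e \<in> exps N. monom_degree e < m} \<subseteq> monom_of N ` ({1..N} \<rightarrow>\<^sub>E {..m})"
  proof
    fix e assume e: "e \<in> {e \<in> exps N. monom_degree e < m}"
    let ?f = "restrict (Poly_Mapping.lookup e) {1..N}"
    have "Poly_Mapping.lookup e i \<le> m" if "i \<in> {1..N}" for i
      using that e monom_degree_exps[of e N] member_le_sum[of i "{1..N}" "Poly_Mapping.lookup e"] by auto
    then have "?f \<in> {1..N} \<rightarrow>\<^sub>E {..m}" by auto
    moreover have "e = monom_of N ?f"
      using e by (intro exps_eqI[of _ N]) (auto simp: monom_of_exps lookup_monom_of)
    ultimately show "e \<in> monom_of N ` ({1..N} \<rightarrow>\<^sub>E {..m})" by blast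
  qed
  show "finite (monom_of N ` ({1..N} \<rightarrow>\<^sub>E {..m}))" by (intro finite_imageI finite_PiE) auto
qed

lemma reduced_exps_bij:
  "bij_betw (\<lambda>e. restrict (Poly_Mapping.lookup e) {1..N}) (reduced_exps N) (\<Pi>\<^sub>E i\<in>{1..N}. {..<gen_degree N i})"
  unfolding bij_betw_def
proof
  show "inj_on (\<lambda>e. restrict (Poly_Mapping.lookup e) {1..N}) (reduced_exps N)"
  proof (rule inj_onI)
    fix e e' assume "e \<in> reduced_exps N" "e' \<in> reduced_exps N"
      and eq: "restrict (Poly_Mapping.lookup e) {1..N} = restrict (Poly_Mapping.lookup e') {1..N}"
    moreover have "Poly_Mapping.lookup e i = Poly_Mapping.lookup e' i" if "i \<in> {1..N}" for i
      using fun_cong[OF eq, of i] that by simp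
    ultimately show "e = e'" by (intro exps_eqI[of _ N]) (auto simp: reduced_exps_def)
  qed
  have "f \<in> (\<lambda>e. restrict (Poly_Mapping.lookup e) {1..N}) ` reduced_exps N"
    if f: "f \<in> (\<Pi>\<^sub>E i\<in>{1..N}. {..<gen_degree N i})" for f
  proof (rule image_eqI)
    show "f = restrict (Poly_Mapping.lookup (monom_of N f)) {1..N}"
      using f by (auto simp: lookup_monom_of fun_eq_iff restrict_def PiE_def extensional_def)
    show "monom_of N f \<in> reduced_exps N"
      using f by (auto simp: reduced_exps_def lookup_monom_of monom_of_exps)
  qed
  then show "(\<lambda>e. restrict (Poly_Mapping.lookup e) {1..N}) ` reduced_exps N = (\<Pi>\<^sub>E i\<in>{1..N}. {..<gen_degree N i})"
    by (auto simp: reduced_exps_def)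
qed

lemma card_reduced_exps:
  assumes "2 \<le> N"
  shows "finite (reduced_exps N)" "card (reduced_exps N) = (N - 1) * fact (N - 1)"
proof -
  show "finite (reduced_exps N)" using bij_betw_finite[OF reduced_exps_bij] by (simp add: finite_PiE)
  have "card (reduced_exps N) = (\<Prod>i\<in>{1..N}. gen_degree N i)"
    using bij_betw_same_card[OF reduced_exps_bij] by (simp add: card_PiE)
  also have "{1..N} = insert N {1..N - 1}" using assms by auto
  also have "(\<Prod>i\<in>insert N {1..N - 1}. gen_degree N i) = gen_degree N N * (\<Prod>i\<in>{1..N - 1}. gen_degree N i)"
    using assms by (intro prod.insert) auto
  also have "(\<Prod>i\<in>{1..N - 1}. gen_degree N i) = (\<Prod>i\<in>{1..N - 1}. i)"
    by (intro prod.cong) (auto simp: gen_degree_def)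
  finally show "card (reduced_exps N) = (N - 1) * fact (N - 1)"
    by (simp add: fact_prod gen_degree_def)
qed

lemma beta_reduced: "e \<in> reduced_exps N \<Longrightarrow> beta N e = basis_monom N e"
  by (auto simp: beta_def reduced_exps_def intro!: prod.neutral)

section \<open>Projections onto sets of monomials\<close>

definition mproj :: "(monom \<Rightarrow> bool) \<Rightarrow> cpoly \<Rightarrow> cpoly"
  where "mproj P = linext (\<lambda>m. if P m then Poly_Mapping.single m 1 else 0)"

lemma mproj_id: "(\<And>m. m \<in> Poly_Mapping.keys p \<Longrightarrow> P m) \<Longrightarrow> mproj P p = p"
  unfolding mproj_def using linext_cong[of p _ "\<lambda>m. Poly_Mapping.single m 1"] linext_id by force

lemma mproj_null: "(\<And>m. m \<in> Poly_Mapping.keys p \<Longrightarrow> \<not> P m) \<Longrightarrow> mproj P p = 0"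
  by (simp add: mproj_def linext_def)

lemma keys_mproj: "Poly_Mapping.keys (mproj P p) \<subseteq> {m \<in> Poly_Mapping.keys p. P m}"
proof -
  have "Poly_Mapping.lookup (mproj P p) m = (if P m then Poly_Mapping.lookup p m else 0)" for m
  proof (induction p rule: cpoly_induct)
    case (single e c)
    then show ?case by (auto simp: mproj_def linext_single scale_single lookup_single when_def)
  qed (simp add: mproj_def linext_add lookup_add)
  then show ?thesis by (auto simp: in_keys_iff split: if_splits)
qed

text \<open>Two uses: restriction to monomials in chosen variables is a ring homomorphism, and a
  homogeneous component of a product with a homogeneous factor is that factor times a component of
  the other.\<close>

lemma mproj_mult:
  assumes "\<And>a b. a \<in> Poly_Mapping.keys p \<Longrightarrow> b \<in> Poly_Mapping.keys q \<Longrightarrow> R (a + b) \<longleftrightarrow> P a \<and> Q b"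
  shows "mproj R (p * q) = mproj P p * mproj Q q"
  unfolding mproj_def using assms by (intro linext_mult[symmetric]) (auto simp: mult_single)

context
  fixes N :: nat
  assumes N: "2 \<le> N"
begin

lemma basis_set_subset: "basis_set N \<subseteq> basis_monom N ` reduced_exps N"
proof
  fix p assume "p \<in> basis_set N"
  then obtain k r where p: "k < N - 1" "\<forall>i\<in>{0<..N - 1}. r i < i"
      "p = (\<Prod>i\<in>{1..k}. var i) * (\<Prod>i\<in>{0<..N - 1}. var (omit_index N (Suc k) i) ^ r i)"
    by (auto simp: basis_set_def box_def)
  \<comment> \<open>Entry N has the bound N - 1, so it can store the layer k; it does not clash with
    the exponents \<open>r i\<close>, which occupy 1 to N - 1.\<close>
  define e where "e = monom_of N (r(N := k))"
  have e: "Poly_Mapping.lookup e N = k" "\<And>i. i \<in> {0<..N - 1} \<Longrightarrow> Poly_Mapping.lookup e i = r i"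
    using N by (auto simp: e_def lookup_monom_of)
  have "e \<in> reduced_exps N"
    unfolding reduced_exps_def using p N by (auto simp: e_def monom_of_exps lookup_monom_of gen_degree_def)
  moreover have "(\<Prod>i\<in>{0<..N - 1}. var (omit_index N (Suc k) i) ^ (Poly_Mapping.lookup e i mod i)) =
      (\<Prod>i\<in>{0<..N - 1}. var (omit_index N (Suc k) i) ^ r i)"
    using p(2) e(2) by (intro prod.cong) auto
  then have "p = basis_monom N e" using e p by (simp add: basis_monom_def)
  ultimately show "p \<in> basis_monom N ` reduced_exps N" by blast
qed

lemma sum_split_last: "(\<Sum>i\<in>{1..N}. f i) = f N + (\<Sum>i\<in>{0<..N - 1}. f i)" for f :: "nat \<Rightarrow> nat"
proof -
  have "{1..N} = insert N {0<..N - 1}" using N by auto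
  then show ?thesis using N by simp
qed

lemma homog_basis_monom:
  "homog {1..N} (\<Sum>i\<in>{1..N}. Poly_Mapping.lookup e i mod gen_degree N i) (basis_monom N e)"
proof -
  let ?k = "Poly_Mapping.lookup e N mod (N - 1)"
  have k: "?k < N - 1" using N by auto
  have 1: "homog {1..N} (\<Sum>i\<in>{1..?k}. 1) (\<Prod>i\<in>{1..?k}. var i)"
    using k by (intro homog_prod homog_var) auto
  have 2: "homog {1..N} (\<Sum>i\<in>{0<..N - 1}. 1 * (Poly_Mapping.lookup e i mod i))
      (\<Prod>i\<in>{0<..N - 1}. var (omit_index N (Suc ?k) i) ^ (Poly_Mapping.lookup e i mod i))"
    by (intro homog_prod homog_power homog_var) (auto simp: omit_index_def)
  have "(\<Sum>i\<in>{1..N}. Poly_Mapping.lookup e i mod gen_degree N i) =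
      ?k + (\<Sum>i\<in>{0<..N - 1}. Poly_Mapping.lookup e i mod gen_degree N i)"
    by (subst sum_split_last) (simp add: gen_degree_def)
  also have "(\<Sum>i\<in>{0<..N - 1}. Poly_Mapping.lookup e i mod gen_degree N i) =
      (\<Sum>i\<in>{0<..N - 1}. 1 * (Poly_Mapping.lookup e i mod i))"
    by (intro sum.cong) (auto simp: gen_degree_def)
  finally show ?thesis using homog_mult[OF 1 2] unfolding basis_monom_def by simp
qed

lemma homog_basis_monom_reduced:
  assumes "e \<in> reduced_exps N"
  shows "homog {1..N} (monom_degree e) (basis_monom N e)"
proof -
  have "monom_degree e = (\<Sum>i\<in>{1..N}. Poly_Mapping.lookup e i mod gen_degree N i)"
    using assms by (auto simp: reduced_exps_def monom_degree_exps)
  then show ?thesis using homog_basis_monom by simp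
qed

lemma deg_less_beta:
  assumes "e \<in> exps N"
  shows "deg_less {1..N} (Suc (monom_degree e)) (beta N e)"
proof -
  let ?l = "Poly_Mapping.lookup e"
  have "deg_less {1..N} ((\<Sum>i\<in>{1..N}. ?l i mod gen_degree N i) +
      Suc (\<Sum>i\<in>{1..N}. gen_degree N i * (?l i div gen_degree N i))) (beta N e)"
    unfolding beta_def
    by (intro deg_less_mult deg_less_prod deg_less_power deg_less_gen N homog_imp_deg_less[OF homog_basis_monom]) auto
  moreover have "(\<Sum>i\<in>{1..N}. ?l i mod gen_degree N i) +
      (\<Sum>i\<in>{1..N}. gen_degree N i * (?l i div gen_degree N i)) = monom_degree e"
    using assms by (simp add: monom_degree_exps flip: sum.distrib)
  ultimately show ?thesis by simp
qed

text \<open>Adding the i-th degree to entry i preserves all remainders, hence the basis monomial,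
  and raises one quotient by 1. So multiplication by a generator is a shift of the index.\<close>

lemma beta_shift:
  assumes "i \<in> {1..N}"
  shows "beta N (e + Poly_Mapping.single i (gen_degree N i)) = gen N i * beta N e"
proof -
  let ?e = "e + Poly_Mapping.single i (gen_degree N i)"
  have l: "Poly_Mapping.lookup ?e j = Poly_Mapping.lookup e j + (if j = i then gen_degree N i else 0)" for j
    by (simp add: lookup_add lookup_single when_def)
  have m: "Poly_Mapping.lookup ?e j mod gen_degree N j = Poly_Mapping.lookup e j mod gen_degree N j" for j
    by (simp add: l)
  have "basis_monom N ?e = basis_monom N e"
  proof -
    have "Poly_Mapping.lookup ?e N mod (N - 1) = Poly_Mapping.lookup e N mod (N - 1)"
      using m[of N] by (simp add: gen_degree_def)
    moreover have "Poly_Mapping.lookup ?e j mod j = Poly_Mapping.lookup e j mod j" if "j \<in> {0<..N - 1}" for j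
    proof -
      have "gen_degree N j = j" using that by (auto simp: gen_degree_def)
      then show ?thesis using m[of j] by simp
    qed
    ultimately show ?thesis unfolding basis_monom_def by simp
  qed
  moreover have "(\<Prod>j\<in>{1..N}. gen N j ^ (Poly_Mapping.lookup ?e j div gen_degree N j)) =
      gen N i * (\<Prod>j\<in>{1..N}. gen N j ^ (Poly_Mapping.lookup e j div gen_degree N j))"
  proof -
    have "(\<Prod>j\<in>{1..N}. gen N j ^ (Poly_Mapping.lookup ?e j div gen_degree N j)) =
      (\<Prod>j\<in>{1..N}. (if j = i then gen N i else 1) * gen N j ^ (Poly_Mapping.lookup e j div gen_degree N j))"
      using gen_degree_pos[OF N] by (intro prod.cong) (auto simp: l)
    then show ?thesis using assms by (simp add: prod.distrib)
  qed
  ultimately show ?thesis by (simp add: beta_def algebra_simps)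
qed

abbreviation in_ring :: "monom \<Rightarrow> bool"
  where "in_ring m \<equiv> Poly_Mapping.keys m \<subseteq> {1..N}"

text \<open>The ideal here is that of the leading forms in the ring with variables \<open>c\<^sub>1,\<dots>,c\<^sub>N\<close>, enlarged by all
  the other variables to an ideal of the whole type.\<close>

lemma spans_top:
  "cp.span (basis_monom N ` reduced_exps N \<union>
    {q. \<exists>h. mproj in_ring q = (\<Sum>i\<in>{1..N}. h i * top_form N i)}) = UNIV"
proof -
  let ?J = "{q. \<exists>h. mproj in_ring q = (\<Sum>i\<in>{1..N}. h i * top_form N i)}"
  have "cp.span (basis_set N \<union> ?J) = UNIV"
  proof (rule basis_set_spans[OF N])
    show "is_ideal ?J"
      unfolding is_ideal_def
    proof (intro conjI ballI allI)
      show "0 \<in> ?J" by (auto simp: mproj_def intro!: exI[of _ "\<lambda>_. 0"])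
      fix p q assume "q \<in> ?J"
      then obtain h where h: "mproj in_ring q = (\<Sum>i\<in>{1..N}. h i * top_form N i)" by blast
      show "p + q \<in> ?J" if p: "p \<in> ?J"
      proof -
        from p obtain h' where "mproj in_ring p = (\<Sum>i\<in>{1..N}. h' i * top_form N i)" by blast
        with h have "mproj in_ring (p + q) = (\<Sum>i\<in>{1..N}. (h' i + h i) * top_form N i)"
          by (simp add: mproj_def linext_add sum.distrib distrib_right)
        then show ?thesis by (intro CollectI exI[of _ "\<lambda>i. h' i + h i"])
      qed
      have "mproj in_ring (p * q) = mproj in_ring p * mproj in_ring q"
        by (rule mproj_mult) (simp add: keys_add_monom)
      then have "mproj in_ring (p * q) = (\<Sum>i\<in>{1..N}. (mproj in_ring p * h i) * top_form N i)"
        by (simp only: h sum_distrib_left mult.assoc)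
      then show "p * q \<in> ?J" by (intro CollectI exI[of _ "\<lambda>i. mproj in_ring p * h i"])
    qed
    show "top_form N i \<in> ?J" if i: "i \<in> {1..N}" for i
    proof -
      have "mproj in_ring (top_form N i) = top_form N i"
        using homog_top_form[OF N i] by (intro mproj_id) (auto simp: homog_def)
      also have "\<dots> = (\<Sum>j\<in>{1..N}. (if j = i then 1 else 0) * top_form N j)"
        using i by (simp add: if_distrib[of "\<lambda>x. x * _"] cong: if_cong)
      finally show ?thesis by (intro CollectI exI[of _ "\<lambda>j. if j = i then 1 else 0"])
    qed
    show "var i \<in> ?J" if "i \<notin> {1..N}" for i
    proof -
      have "mproj in_ring (var i) = 0" using that by (intro mproj_null) (auto simp: var_def)
      then show ?thesis by (intro CollectI exI[of _ "\<lambda>_. 0"]) simp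
    qed
  qed
  moreover have "cp.span (basis_set N \<union> ?J) \<subseteq> cp.span (basis_monom N ` reduced_exps N \<union> ?J)"
    using basis_set_subset by (intro cp.span_mono) auto
  ultimately show ?thesis by auto
qed

abbreviation beta_span :: "nat \<Rightarrow> cpoly set"
  where "beta_span m \<equiv> cp.span (beta N ` {e \<in> exps N. monom_degree e < m})"

lemma gen_mult_beta_span:
  assumes "i \<in> {1..N}" "p \<in> beta_span m"
  shows "p * gen N i \<in> beta_span (m + gen_degree N i)"
proof (rule span_mult_mem[OF _ _ assms(2)])
  fix x assume "x \<in> beta N ` {e \<in> exps N. monom_degree e < m}"
  then obtain e where e: "x = beta N e" "e \<in> exps N" "monom_degree e < m" by auto
  let ?e = "e + Poly_Mapping.single i (gen_degree N i)"
  have "?e \<in> exps N" "monom_degree ?e < m + gen_degree N i"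
    using e assms by (auto simp: exps_def keys_add_monom monom_degree_add)
  moreover have "x * gen N i = beta N ?e" using assms e by (simp add: beta_shift mult.commute)
  ultimately show "x * gen N i \<in> beta_span (m + gen_degree N i)" by (auto intro!: cp.span_base)
qed simp

text \<open>A monomial of degree d is a combination of basis monomials plus a sum of h_i t_i with
  the leading forms t_i, and both parts can be cut down to degree d. In h_i t_i = h_i g_i + h_i (t_i
  - g_i) the first term is a shift of elements of smaller index, and the second has degree below
  d.\<close>

lemma beta_spans: "deg_less {1..N} m p \<Longrightarrow> p \<in> beta_span m"
proof (induction m arbitrary: p rule: less_induct)
  case (less m)
  let ?W = "beta_span m"
  have mono: "beta_span m' \<subseteq> ?W" if "m' \<le> m" for m'
    using that by (intro cp.span_mono image_mono) auto
  have "Poly_Mapping.single e 1 \<in> ?W" if e: "in_ring e" "monom_degree e < m" for e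
  proof -
    let ?d = "monom_degree e" and ?A = "{1..N}"
    let ?J = "{q. \<exists>h. mproj in_ring q = (\<Sum>i\<in>{1..N}. h i * top_form N i)}"
    let ?P = "\<lambda>m. in_ring m \<and> monom_degree m = ?d"
    let ?x = "Poly_Mapping.single e (1 :: complex)"
    have sJ: "cp.subspace ?J"
    proof -
      have "cp.subspace {p. linext \<phi> p \<in> W}" if "cp.subspace W" for \<phi> W
        using that by (auto simp: cp.subspace_def linext_add linext_scale)
      moreover have "cp.subspace {q. \<exists>h. q = (\<Sum>i\<in>{1..N}. h i * top_form N i)}"
      proof (rule cp.subspaceI)
        fix x y c assume "x \<in> {q. \<exists>h. q = (\<Sum>i\<in>{1..N}. h i * top_form N i)}"
        then obtain h where h: "x = (\<Sum>i\<in>{1..N}. h i * top_form N i)" by blast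
        have "scale c x = (\<Sum>i\<in>{1..N}. scale c (h i) * top_form N i)"
          by (simp add: h scale_def sum_distrib_left mult.assoc)
        then show "scale c x \<in> {q. \<exists>h. q = (\<Sum>i\<in>{1..N}. h i * top_form N i)}"
          by (intro CollectI exI[of _ "\<lambda>i. scale c (h i)"])
        assume "y \<in> {q. \<exists>h. q = (\<Sum>i\<in>{1..N}. h i * top_form N i)}"
        then obtain h' where "y = (\<Sum>i\<in>{1..N}. h' i * top_form N i)" by blast
        then have "x + y = (\<Sum>i\<in>{1..N}. (h i + h' i) * top_form N i)"
          by (simp add: h distrib_right sum.distrib)
        then show "x + y \<in> {q. \<exists>h. q = (\<Sum>i\<in>{1..N}. h i * top_form N i)}"
          by (intro CollectI exI[of _ "\<lambda>i. h i + h' i"])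
      qed (auto intro!: exI[of _ "\<lambda>_. 0"])
      ultimately show ?thesis unfolding mproj_def by force
    qed
    have "?x \<in> cp.span (basis_monom N ` reduced_exps N \<union> ?J)" unfolding spans_top ..
    then obtain s j where sj: "?x = s + j" "s \<in> cp.span (basis_monom N ` reduced_exps N)" "j \<in> ?J"
      unfolding cp.span_Un cp.span_eq_iff[THEN iffD2, OF sJ] by blast
    from sj(3) obtain h where h: "mproj in_ring j = (\<Sum>i\<in>{1..N}. h i * top_form N i)" by blast
    have "mproj ?P s \<in> ?W"
    proof -
      have "cp.subspace {p. mproj ?P p \<in> ?W}"
        by (auto simp: cp.subspace_def mproj_def linext_add linext_scale cp.span_zero
            intro: cp.span_add cp.span_scale)
      moreover have "mproj ?P (basis_monom N e') \<in> ?W" if e': "e' \<in> reduced_exps N" for e'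
      proof (cases "monom_degree e' = ?d")
        case True
        have "mproj ?P (basis_monom N e') = basis_monom N e'"
          using homog_basis_monom_reduced[OF e'] True by (intro mproj_id) (auto simp: homog_def)
        then show ?thesis using True e e'
          by (auto simp: beta_reduced[symmetric] reduced_exps_def intro!: cp.span_base)
      next
        case False
        have "mproj ?P (basis_monom N e') = 0"
          using homog_basis_monom_reduced[OF e'] False by (intro mproj_null) (auto simp: homog_def)
        then show ?thesis by (simp add: cp.span_zero)
      qed
      ultimately show ?thesis
        using cp.span_minimal[of "basis_monom N ` reduced_exps N" "{p. mproj ?P p \<in> ?W}"] sj(2) by blast
    qed
    moreover have "mproj ?P j \<in> ?W"
    proof -
      \<comment> \<open>The component of degree d - d_i, written additively: for d_i > d no monomial
        qualifies and \<open>h' i\<close> is zero.\<close>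
      define h' where "h' i = mproj (\<lambda>m. in_ring m \<and> monom_degree m + gen_degree N i = ?d) (h i)" for i
      have "mproj ?P j = mproj ?P (mproj in_ring j)"
      proof (induction j rule: cpoly_induct)
        case (single m c)
        then show ?case by (simp add: mproj_def linext_single linext_scale scale_single)
      qed (simp add: mproj_def linext_add)
      also have "\<dots> = (\<Sum>i\<in>?A. mproj ?P (h i * top_form N i))"
        unfolding h by (simp add: mproj_def linext_sum)
      also have "\<dots> = (\<Sum>i\<in>?A. h' i * top_form N i)"
      proof (rule sum.cong[OF refl])
        fix i assume i: "i \<in> ?A"
        have "mproj ?P (h i * top_form N i) = h' i * mproj (\<lambda>_. True) (top_form N i)"
          unfolding h'_def using homog_top_form[OF N i]
          by (intro mproj_mult) (auto simp: homog_def keys_add_monom monom_degree_add)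
        then show "mproj ?P (h i * top_form N i) = h' i * top_form N i" by (simp add: mproj_id)
      qed
      also have "\<dots> \<in> ?W"
      proof (rule cp.span_sum)
        fix i assume i: "i \<in> ?A"
        show "h' i * top_form N i \<in> ?W"
        proof (cases "gen_degree N i \<le> ?d")
          case False
          then have "h' i = 0" unfolding h'_def by (intro mproj_null) auto
          then show ?thesis by (simp add: cp.span_zero)
        next
          case True
          let ?r = "?d - gen_degree N i"
          have d: "deg_less ?A (Suc ?r) (h' i)"
            unfolding h'_def deg_less_def using keys_mproj by fastforce
          \<comment> \<open>The positive degree of the generator makes the bound for
            \<open>h' i\<close> smaller than \<open>m\<close>, as the induction hypothesis
            requires.\<close>
          have "Suc ?r + gen_degree N i \<le> m" "Suc ?r < m" using True e(2) gen_degree_pos[OF N i] by auto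
          then have 1: "h' i * gen N i \<in> ?W"
            using less(1)[OF _ d] gen_mult_beta_span[OF i, of "h' i" "Suc ?r"] mono by blast
          have "deg_less ?A (?r + gen_degree N i) (h' i * (top_form N i - gen N i))"
            by (rule deg_less_mult[OF d deg_less_gen_top_form[OF N i]])
          then have "h' i * (top_form N i - gen N i) \<in> beta_span ?d"
            using less(1)[of ?d] e(2) True by simp
          then have 2: "h' i * (top_form N i - gen N i) \<in> ?W" using mono[of ?d] e(2) by auto
          show ?thesis using cp.span_add[OF 1 2] by (simp add: algebra_simps)
        qed
      qed
      finally show ?thesis .
    qed
    moreover have "?x = mproj ?P s + mproj ?P j"
    proof -
      have "mproj ?P ?x = ?x" using e by (intro mproj_id) auto
      then show ?thesis unfolding sj(1) by (simp add: mproj_def linext_add)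
    qed
    ultimately show ?thesis by (simp only: cp.span_add)
  qed
  then have "scale (Poly_Mapping.lookup p e) (Poly_Mapping.single e 1) \<in> ?W"
    if "e \<in> Poly_Mapping.keys p" for e
    using that less(2) by (intro cp.span_scale) (auto simp: deg_less_def)
  then have "linext (\<lambda>e. Poly_Mapping.single e 1) p \<in> ?W"
    unfolding linext_def by (rule cp.span_sum)
  then show ?case by (simp add: linext_id)
qed

end

section \<open>The quotient by the ideal\<close>

lemma span_Int_independent:
  assumes "cp.independent (X \<union> Y)" "X \<inter> Y = {}" "p \<in> cp.span X" "p \<in> cp.span Y"
  shows "p = 0"
proof -
  have "cp.representation (X \<union> Y) p = cp.representation X p"
    "cp.representation (X \<union> Y) p = cp.representation Y p"
    using assms by (auto intro!: cp.representation_extend)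
  then have eq: "cp.representation X p x = cp.representation Y p x" for x by metis
  have "cp.representation X p x = 0" for x
  proof (rule ccontr)
    assume "cp.representation X p x \<noteq> 0"
    then have "x \<in> X" "x \<in> Y" using cp.representation_ne_zero eq by metis+
    then show False using assms(2) by blast
  qed
  moreover have "cp.independent X" using assms(1) by (rule cp.independent_mono) simp
  ultimately show ?thesis
    using cp.sum_nonzero_representation_eq[of X p] assms(3) by simp
qed

lemma independent_monomials:
  assumes "finite E"
  shows "cp.independent ((\<lambda>e. Poly_Mapping.single e 1) ` E)"
proof (rule cp.independent_if_scalars_zero)
  fix f x assume s: "(\<Sum>x\<in>(\<lambda>e. Poly_Mapping.single e 1) ` E. scale (f x) x) = 0"
    and "x \<in> (\<lambda>e. Poly_Mapping.single e (1::complex)) ` E"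
  then obtain e where e: "x = Poly_Mapping.single e 1" "e \<in> E" by blast
  have inj: "inj_on (\<lambda>e. Poly_Mapping.single e (1::complex)) E"
    by (rule inj_onI) (metis lookup_single_eq lookup_single_not_eq zero_neq_one)
  have "(\<Sum>e\<in>E. Poly_Mapping.single e (f (Poly_Mapping.single e 1))) = 0"
    using s by (simp add: sum.reindex[OF inj] scale_single)
  then have "Poly_Mapping.lookup (\<Sum>e\<in>E. Poly_Mapping.single e (f (Poly_Mapping.single e 1))) e = 0"
    by simp
  then show "f x = 0" using assms e by (simp add: lookup_sum lookup_single when_def)
qed (use assms in simp)

lemma ex_deg_less:
  assumes "vars p \<subseteq> A"
  shows "\<exists>m. deg_less A m p"
proof -
  let ?m = "Suc (\<Sum>e\<in>Poly_Mapping.keys p. monom_degree e)"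
  have "monom_degree e < ?m" if "e \<in> Poly_Mapping.keys p" for e
    using member_le_sum[of e "Poly_Mapping.keys p" monom_degree] that by (simp add: less_Suc_eq_le)
  then have "deg_less A ?m p" using assms by (auto simp: deg_less_def vars_def)
  then show ?thesis ..
qed

lemma deg_less_vars: "deg_less A m p \<Longrightarrow> vars p \<subseteq> A"
  by (auto simp: deg_less_def vars_def)

lemma vars_Const [simp]: "vars (Const c) = {}"
  by (simp add: vars_def Const_def)

lemma vars_scale: "vars (scale c p) \<subseteq> vars p"
  using vars_mult[of "Const c" p] by (simp add: scale_def)

lemma ideal_poly_ringI:
  assumes "I \<subseteq> carrier (poly_ring A)" "0 \<in> I" "\<And>p q. p \<in> I \<Longrightarrow> q \<in> I \<Longrightarrow> p + q \<in> I"
    and mult: "\<And>p q. vars p \<subseteq> A \<Longrightarrow> q \<in> I \<Longrightarrow> p * q \<in> I"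
  shows "ideal I (poly_ring A)"
proof -
  interpret cring "poly_ring A" by (rule cring_poly_ring)
  have mult': "q * p \<in> I" if "vars p \<subseteq> A" "q \<in> I" for p q
    using mult[OF that] by (simp add: mult.commute)
  show ?thesis
  proof (rule idealI)
    show "ring (poly_ring A)" by (rule ring_axioms)
    show "subgroup I (add_monoid (poly_ring A))"
    proof
      show "I \<subseteq> carrier (add_monoid (poly_ring A))" using assms(1) by simp
      fix x assume x: "x \<in> I"
      then have "- x \<in> I" using mult[of "- 1" x] by simp
      moreover have "\<ominus>\<^bsub>poly_ring A\<^esub> x = - x"
        using x calculation assms(1) by (intro minus_equality) auto
      ultimately show "inv\<^bsub>add_monoid (poly_ring A)\<^esub> x \<in> I" by (simp add: a_inv_def)
    qed (use assms in auto)
  qed (use mult mult' in auto)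
qed

lemma ideal_poly_ringD:
  assumes "ideal I (poly_ring A)"
  shows "p \<in> I \<Longrightarrow> vars p \<subseteq> A" "0 \<in> I" "p \<in> I \<Longrightarrow> q \<in> I \<Longrightarrow> p + q \<in> I"
    "vars p \<subseteq> A \<Longrightarrow> q \<in> I \<Longrightarrow> p * q \<in> I"
proof -
  interpret ideal I "poly_ring A" by (rule assms)
  show "p \<in> I \<Longrightarrow> vars p \<subseteq> A" using a_subset by auto
  show "0 \<in> I" using additive_subgroup.zero_closed[OF additive_subgroup_axioms] by simp
  show "p \<in> I \<Longrightarrow> q \<in> I \<Longrightarrow> p + q \<in> I" using additive_subgroup.a_closed[OF additive_subgroup_axioms] by simp
  show "vars p \<subseteq> A \<Longrightarrow> q \<in> I \<Longrightarrow> p * q \<in> I" using I_l_closed by simp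
qed

lemma ideal_poly_ring_sum:
  assumes "ideal I (poly_ring A)" "\<And>i. i \<in> S \<Longrightarrow> f i \<in> I"
  shows "sum f S \<in> I"
  using assms(2)
  by (induction S rule: infinite_finite_induct) (auto simp: ideal_poly_ringD[OF assms(1)])

section \<open>Independence of the family and normal forms modulo the ideal\<close>

context
  fixes N :: nat
  assumes N: "2 \<le> N"
begin

text \<open>The monomials of degree below m are independent and lie in the span of the
  \<open>beta\<close> with the same index set. So fewer than \<open>card (E m)\<close> elements
  cannot span them: the \<open>beta\<close> are distinct, and none of them is redundant.\<close>

lemma beta_independent_bounded:
  defines "E m \<equiv> {e \<in> exps N. monom_degree e < m}"
  shows "cp.independent (beta N ` E m)" "inj_on (beta N) (E m)"
proof -
  let ?X = "(\<lambda>e. Poly_Mapping.single e (1::complex)) ` E m"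
  have fin: "finite (E m)" unfolding E_def by (rule finite_exps)
  have inj: "inj_on (\<lambda>e. Poly_Mapping.single e (1::complex)) (E m)"
    by (rule inj_onI) (metis lookup_single_eq lookup_single_not_eq zero_neq_one)
  have X: "cp.independent ?X" "card ?X = card (E m)"
    using independent_monomials[OF fin] card_image[OF inj] by auto
  have "x \<in> cp.span (beta N ` E m)" if "x \<in> ?X" for x
    unfolding E_def using that by (intro beta_spans[OF N]) (auto simp: deg_less_def E_def exps_def)
  then have sub: "?X \<subseteq> cp.span (beta N ` E m)" by blast
  have le: "card (E m) \<le> card Y" if "finite Y" "?X \<subseteq> cp.span Y" for Y
    using cp.independent_span_bound[OF that(1) X(1) that(2)] X(2) by simp
  have c: "card (beta N ` E m) = card (E m)"
    using le[OF _ sub] card_image_le[OF fin, of "beta N"] fin by simp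
  then show "inj_on (beta N) (E m)" by (rule eq_card_imp_inj_on[OF fin])
  show "cp.independent (beta N ` E m)"
  proof
    assume "cp.dependent (beta N ` E m)"
    then obtain a where a: "a \<in> beta N ` E m" "a \<in> cp.span (beta N ` E m - {a})"
      unfolding cp.dependent_def by blast
    then have "cp.span (beta N ` E m - {a}) = cp.span (beta N ` E m)"
      using cp.span_redundant[of a "beta N ` E m - {a}"] by (simp add: insert_absorb)
    then have "card (E m) \<le> card (beta N ` E m - {a})" using le sub fin by simp
    then show False using a c fin by (metis card_Diff1_less finite_imageI leD)
  qed
qed

lemma exps_bound:
  assumes "finite E" "E \<subseteq> exps N"
  obtains m where "E \<subseteq> {e \<in> exps N. monom_degree e < m}"
proof
  show "E \<subseteq> {e \<in> exps N. monom_degree e < Suc (\<Sum>e\<in>E. monom_degree e)}"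
    using assms member_le_sum[of _ E monom_degree] by (auto simp: less_Suc_eq_le)
qed

lemma beta_inj: "inj_on (beta N) (exps N)"
proof (rule inj_onI)
  fix e e' assume e: "e \<in> exps N" "e' \<in> exps N" "beta N e = beta N e'"
  obtain m where "{e, e'} \<subseteq> {e \<in> exps N. monom_degree e < m}"
    by (rule exps_bound[of "{e, e'}"]) (use e in auto)
  then show "e = e'" using inj_onD[OF beta_independent_bounded(2), of e e' m] e(3) by blast
qed

lemma beta_independent: "cp.independent (beta N ` exps N)"
  unfolding cp.independent_explicit_finite_subsets
proof (intro allI impI ballI)
  fix S u v
  assume S: "S \<subseteq> beta N ` exps N" "finite S" "(\<Sum>v\<in>S. scale (u v) v) = 0" "v \<in> S"
  obtain E where E: "E \<subseteq> exps N" "finite E" "S = beta N ` E"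
    using finite_subset_image[OF S(2,1)] by blast
  obtain m where "E \<subseteq> {e \<in> exps N. monom_degree e < m}" using exps_bound[OF E(2,1)] .
  then have "S \<subseteq> beta N ` {e \<in> exps N. monom_degree e < m}" using E(3) by blast
  then have "cp.independent S" by (rule cp.independent_mono[OF beta_independent_bounded(1)])
  then show "u v = 0" using S unfolding cp.independent_explicit_finite_subsets by blast
qed

lemma ring_span_beta:
  assumes "vars p \<subseteq> {1..N}"
  shows "p \<in> cp.span (beta N ` exps N)"
proof -
  obtain m where "deg_less {1..N} m p" using ex_deg_less[OF assms] ..
  then have "p \<in> cp.span (beta N ` {e \<in> exps N. monom_degree e < m})" by (rule beta_spans[OF N])
  moreover have "\<dots> \<subseteq> cp.span (beta N ` exps N)" by (intro cp.span_mono) auto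
  ultimately show ?thesis by blast
qed

lemma generators_eq: "generators N = gen N ` {1..N}"
proof -
  have "{1..N} = insert N {1..<N}" using N by auto
  then show ?thesis by (auto simp: generators_def gen_def image_iff)
qed

lemma vars_gen:
  assumes "i \<in> {1..N}"
  shows "vars (gen N i) \<subseteq> {1..N}"
proof -
  have "0 < N" using N by simp
  from generators_in_carrier[OF this] have "gen N i \<in> carrier (poly_ring {1..N})"
    using assms unfolding generators_eq by blast
  then show ?thesis by simp
qed

lemma I_tilde_ideal: "ideal (I_tilde N) (poly_ring {1..N})"
  and gen_I_tilde: "i \<in> {1..N} \<Longrightarrow> gen N i \<in> I_tilde N"
proof -
  interpret cring "poly_ring {1..N}" by (rule cring_poly_ring)
  have g: "generators N \<subseteq> carrier (poly_ring {1..N})" using generators_in_carrier N by simp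
  show "ideal (I_tilde N) (poly_ring {1..N})" unfolding I_tilde_def by (rule genideal_ideal[OF g])
  show "i \<in> {1..N} \<Longrightarrow> gen N i \<in> I_tilde N"
    unfolding I_tilde_def using genideal_self[OF g] by (auto simp: generators_eq)
qed

lemma I_tilde_elem:
  assumes "p \<in> I_tilde N"
  obtains h where "p = (\<Sum>i\<in>{1..N}. h i * gen N i)" "\<And>i. vars (h i) \<subseteq> {1..N}"
proof -
  let ?A = "{1..N}"
  let ?I = "{p. \<exists>h. p = (\<Sum>i\<in>?A. h i * gen N i) \<and> (\<forall>i. vars (h i) \<subseteq> ?A)}"
  interpret cring "poly_ring ?A" by (rule cring_poly_ring)
  have "ideal ?I (poly_ring ?A)"
  proof (rule ideal_poly_ringI)
    show "?I \<subseteq> carrier (poly_ring ?A)"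
    proof
      fix p assume "p \<in> ?I"
      then obtain h where h: "p = (\<Sum>i\<in>?A. h i * gen N i)" "\<And>i. vars (h i) \<subseteq> ?A" by blast
      have "vars p \<subseteq> ?A"
        unfolding h(1) using vars_mult h(2) vars_gen by (intro vars_sum) blast
      then show "p \<in> carrier (poly_ring ?A)" by simp
    qed
    show "0 \<in> ?I" by (intro CollectI exI[of _ "\<lambda>_. 0"]) simp
  next
    fix p q assume "p \<in> ?I" "q \<in> ?I"
    then obtain h h' where h: "p = (\<Sum>i\<in>?A. h i * gen N i)" "\<forall>i. vars (h i) \<subseteq> ?A"
      "q = (\<Sum>i\<in>?A. h' i * gen N i)" "\<forall>i. vars (h' i) \<subseteq> ?A" by blast
    have "vars (h i + h' i) \<subseteq> ?A" for i
      using vars_add[of "h i" "h' i"] h(2,4) by blast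
    then show "p + q \<in> ?I"
      unfolding h(1,3) by (intro CollectI exI[of _ "\<lambda>i. h i + h' i"]) (simp add: distrib_right sum.distrib)
  next
    fix p q assume p: "vars p \<subseteq> ?A" and "q \<in> ?I"
    then obtain h where h: "q = (\<Sum>i\<in>?A. h i * gen N i)" "\<forall>i. vars (h i) \<subseteq> ?A" by blast
    have "vars (p * h i) \<subseteq> ?A" for i using vars_mult[of p "h i"] h(2) p by blast
    then show "p * q \<in> ?I"
      unfolding h(1) by (intro CollectI exI[of _ "\<lambda>i. p * h i"]) (simp add: sum_distrib_left mult.assoc)
  qed
  moreover have "generators N \<subseteq> ?I"
  proof
    fix g assume "g \<in> generators N"
    then obtain i where i: "g = gen N i" "i \<in> ?A" by (auto simp: generators_eq)
    then have "g = (\<Sum>j\<in>?A. (if j = i then 1 else 0) * gen N j)"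
      by (simp add: if_distrib[of "\<lambda>x. x * _"] cong: if_cong)
    then show "g \<in> ?I" by (intro CollectI exI[of _ "\<lambda>j. if j = i then 1 else 0"]) simp
  qed
  ultimately have "I_tilde N \<subseteq> ?I" unfolding I_tilde_def by (rule genideal_minimal)
  then show thesis using assms that by blast
qed

text \<open>The coefficients of a member of the ideal expand in the \<open>beta\<close>, and
  multiplication by the i-th generator shifts each index to one whose entry i reaches the i-th
  degree.\<close>

lemma I_tilde_span: "I_tilde N \<subseteq> cp.span (beta N ` (exps N - reduced_exps N))"
proof
  fix p assume "p \<in> I_tilde N"
  then obtain h where h: "p = (\<Sum>i\<in>{1..N}. h i * gen N i)" "\<And>i. vars (h i) \<subseteq> {1..N}"
    using I_tilde_elem by metis
  have "h i * gen N i \<in> cp.span (beta N ` (exps N - reduced_exps N))" if i: "i \<in> {1..N}" for i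
  proof (rule span_mult_mem[OF _ _ ring_span_beta[OF h(2)]])
    fix x assume "x \<in> beta N ` exps N"
    then obtain e where e: "x = beta N e" "e \<in> exps N" by auto
    let ?e = "e + Poly_Mapping.single i (gen_degree N i)"
    have "?e \<in> exps N" using e(2) i by (auto simp: exps_def keys_add_monom)
    moreover have "\<not> Poly_Mapping.lookup ?e i < gen_degree N i" by (simp add: lookup_add)
    then have "?e \<notin> reduced_exps N" using i by (auto simp: reduced_exps_def)
    moreover have "x * gen N i = beta N ?e" using beta_shift[OF N i] e by (simp add: mult.commute)
    ultimately show "x * gen N i \<in> cp.span (beta N ` (exps N - reduced_exps N))"
      by (auto intro!: cp.span_base)
  qed simp
  then show "p \<in> cp.span (beta N ` (exps N - reduced_exps N))" unfolding h(1) by (rule cp.span_sum)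
qed

text \<open>Reduced and non-reduced indices give disjoint parts of one independent family. With
  \<open>normal_form\<close>, the basis monomials thus represent a basis of R/I.\<close>

lemma I_tilde_disjoint:
  assumes "p \<in> cp.span (basis_monom N ` reduced_exps N)" "p \<in> I_tilde N"
  shows "p = 0"
proof (rule span_Int_independent)
  have "basis_monom N ` reduced_exps N = beta N ` reduced_exps N" using beta_reduced by force
  then show "p \<in> cp.span (beta N ` reduced_exps N)" using assms(1) by simp
  show "p \<in> cp.span (beta N ` (exps N - reduced_exps N))" using I_tilde_span assms(2) by blast
  have "reduced_exps N \<subseteq> exps N" by (auto simp: reduced_exps_def)
  then show "cp.independent (beta N ` reduced_exps N \<union> beta N ` (exps N - reduced_exps N))"
    using beta_independent by (simp add: Un_absorb1 flip: image_Un)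
  show "beta N ` reduced_exps N \<inter> beta N ` (exps N - reduced_exps N) = {}"
    using inj_on_image_Int[OF beta_inj, of "reduced_exps N" "exps N - reduced_exps N"]
      \<open>reduced_exps N \<subseteq> exps N\<close> by auto
qed

lemma card_basis_monom: "card (basis_monom N ` reduced_exps N) = (N - 1) * fact (N - 1)"
  and basis_monom_independent: "cp.independent (basis_monom N ` reduced_exps N)"
proof -
  have eq: "basis_monom N ` reduced_exps N = beta N ` reduced_exps N" using beta_reduced by force
  have sub: "reduced_exps N \<subseteq> exps N" by (auto simp: reduced_exps_def)
  show "card (basis_monom N ` reduced_exps N) = (N - 1) * fact (N - 1)"
    unfolding eq using card_image[OF inj_on_subset[OF beta_inj sub]] card_reduced_exps[OF N] by simp
  show "cp.independent (basis_monom N ` reduced_exps N)"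
    unfolding eq using sub by (intro cp.independent_mono[OF beta_independent]) auto
qed

lemma subspace_I_tilde: "cp.subspace (I_tilde N)"
  using ideal_poly_ringD[OF I_tilde_ideal]
  by (auto simp: cp.subspace_def scale_def)

text \<open>For a non-reduced index some entry reaches the degree of its generator, so that
  \<open>beta\<close> has this generator as a factor and vanishes modulo the ideal.\<close>

lemma normal_form:
  assumes "vars p \<subseteq> {1..N}"
  shows "\<exists>s\<in>cp.span (basis_monom N ` reduced_exps N). p - s \<in> I_tilde N"
proof -
  have "beta N e \<in> basis_monom N ` reduced_exps N \<union> I_tilde N" if e: "e \<in> exps N" for e
  proof (cases "e \<in> reduced_exps N")
    case False
    then obtain i where i: "i \<in> {1..N}" "gen_degree N i \<le> Poly_Mapping.lookup e i"
      using e by (auto simp: reduced_exps_def not_less)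
    let ?e = "e - Poly_Mapping.single i (gen_degree N i)"
    have "e = ?e + Poly_Mapping.single i (gen_degree N i)"
      by (rule poly_mapping_eqI)
        (use i(2) in \<open>auto simp: lookup_add lookup_minus lookup_single when_def\<close>)
    then have b: "beta N e = beta N ?e * gen N i"
      using beta_shift[OF N i(1), of ?e] by (simp add: mult.commute)
    have "?e \<in> exps N" using e by (auto simp: exps_def in_keys_iff lookup_minus subset_iff)
    then have "vars (beta N ?e) \<subseteq> {1..N}" using deg_less_vars[OF deg_less_beta[OF N]] by blast
    then have "beta N e \<in> I_tilde N"
      unfolding b using ideal_poly_ringD(4)[OF I_tilde_ideal] gen_I_tilde i(1) by blast
    then show ?thesis by simp
  qed (simp add: beta_reduced)
  then have "cp.span (beta N ` exps N) \<subseteq> cp.span (basis_monom N ` reduced_exps N \<union> I_tilde N)"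
    by (intro cp.span_mono) auto
  then have "p \<in> cp.span (basis_monom N ` reduced_exps N \<union> I_tilde N)" using ring_span_beta[OF assms] by blast
  then obtain s q where "p = s + q" "s \<in> cp.span (basis_monom N ` reduced_exps N)" "q \<in> I_tilde N"
    unfolding cp.span_Un cp.span_eq_iff[THEN iffD2, OF subspace_I_tilde] by blast
  then show ?thesis by (intro bexI[of _ s]) auto
qed

lemma vars_basis_span:
  assumes "s \<in> cp.span (basis_monom N ` reduced_exps N)"
  shows "vars s \<subseteq> {1..N}"
proof -
  have "cp.subspace {p. vars p \<subseteq> {1..N}}"
  proof (rule cp.subspaceI)
    show "x + y \<in> {p. vars p \<subseteq> {1..N}}" if "x \<in> {p. vars p \<subseteq> {1..N}}" "y \<in> {p. vars p \<subseteq> {1..N}}" for x y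
      using that vars_add[of x y] by auto
    show "scale c x \<in> {p. vars p \<subseteq> {1..N}}" if "x \<in> {p. vars p \<subseteq> {1..N}}" for x c
      using that vars_scale[of c x] by auto
  qed simp
  moreover have "basis_monom N ` reduced_exps N \<subseteq> {p. vars p \<subseteq> {1..N}}"
    using homog_basis_monom_reduced[OF N] by (fastforce simp: homog_def vars_def)
  ultimately show ?thesis using cp.span_minimal assms by blast
qed

end

section \<open>Radicality and the Nullstellensatz\<close>

lemma linext_linext: "linext \<psi> (linext \<phi> p) = linext (\<lambda>m. linext \<psi> (\<phi> m)) p"
  by (induction p rule: cpoly_induct) (simp_all add: linext_single linext_scale linext_add)

text \<open>Unlike \<open>homogenize\<close>, it is linear in the polynomial, as the target degree
  is fixed. It is a true homogenization for polynomials of degree at most \<open>d\<close>.\<close>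

definition homogenize_at :: "nat \<Rightarrow> cpoly \<Rightarrow> cpoly"
  where "homogenize_at d = linext (\<lambda>e. Poly_Mapping.single (e + Poly_Mapping.single 0 (d - monom_degree e)) 1)"

text \<open>The substitution of 1 for C_0.\<close>

definition dehomogenize :: "cpoly \<Rightarrow> cpoly"
  where "dehomogenize =
    linext (\<lambda>e. Poly_Mapping.single (e - Poly_Mapping.single 0 (Poly_Mapping.lookup e 0)) 1)"

lemma homogenize_eq: "homogenize p = homogenize_at (total_degree p) p"
  by (simp add: homogenize_def homogenize_at_def linext_def scale_single)

lemma homogenize_at_mult:
  assumes "deg_less UNIV (Suc a) p" "deg_less UNIV (Suc b) q"
  shows "homogenize_at a p * homogenize_at b q = homogenize_at (a + b) (p * q)"
  unfolding homogenize_at_def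
proof (rule linext_mult)
  fix e e' assume "e \<in> Poly_Mapping.keys p" "e' \<in> Poly_Mapping.keys q"
  then have "monom_degree e \<le> a" "monom_degree e' \<le> b"
    using assms by (auto simp: deg_less_def less_Suc_eq_le)
  then have "a + b - monom_degree (e + e') = (a - monom_degree e) + (b - monom_degree e')"
    by (simp add: monom_degree_add)
  then show "Poly_Mapping.single (e + Poly_Mapping.single 0 (a - monom_degree e)) 1 *
      Poly_Mapping.single (e' + Poly_Mapping.single 0 (b - monom_degree e')) 1 =
      Poly_Mapping.single (e + e' + Poly_Mapping.single 0 (a + b - monom_degree (e + e'))) (1 :: complex)"
    by (simp add: mult_single single_add algebra_simps)
qed

lemma homogenize_at_power:
  assumes "deg_less UNIV (Suc a) p"
  shows "homogenize_at a p ^ n = homogenize_at (a * n) (p ^ n)"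
proof (induction n)
  case 0
  show ?case using linext_single[of _ 0 1] by (simp add: homogenize_at_def scale_def flip: single_one)
next
  case (Suc n)
  then show ?case using homogenize_at_mult[OF assms deg_less_power[OF assms]] by simp
qed

lemma vars_linext:
  assumes "\<And>m. m \<in> Poly_Mapping.keys p \<Longrightarrow> vars (\<phi> m) \<subseteq> A"
  shows "vars (linext \<phi> p) \<subseteq> A"
  unfolding linext_def using assms vars_scale by (intro vars_sum) blast

lemma vars_single: "vars (Poly_Mapping.single m c) \<subseteq> Poly_Mapping.keys m"
  by (simp add: vars_def)

lemma vars_homogenize_at: "vars p \<subseteq> A \<Longrightarrow> vars (homogenize_at d p) \<subseteq> insert 0 A"
  unfolding homogenize_at_def
  by (rule vars_linext, rule order_trans[OF vars_single])
    (auto simp: keys_add_monom vars_def split: if_splits)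

lemma vars_dehomogenize:
  assumes "vars p \<subseteq> insert 0 A"
  shows "vars (dehomogenize p) \<subseteq> A"
  unfolding dehomogenize_def
proof (rule vars_linext, rule order_trans[OF vars_single])
  fix m assume "m \<in> Poly_Mapping.keys p"
  then have "Poly_Mapping.keys m \<subseteq> insert 0 A" using assms by (auto simp: vars_def)
  moreover have "Poly_Mapping.keys (m - Poly_Mapping.single 0 (Poly_Mapping.lookup m 0)) \<subseteq>
      Poly_Mapping.keys m - {0}"
    by (auto simp: in_keys_iff lookup_minus lookup_single when_def split: if_splits)
  ultimately show "Poly_Mapping.keys (m - Poly_Mapping.single 0 (Poly_Mapping.lookup m 0)) \<subseteq> A"
    by blast
qed

lemma dehomogenize_mult: "dehomogenize (p * q) = dehomogenize p * dehomogenize q"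
proof -
  have "a - Poly_Mapping.single 0 (Poly_Mapping.lookup a 0) +
      (b - Poly_Mapping.single 0 (Poly_Mapping.lookup b 0)) =
      a + b - Poly_Mapping.single 0 (Poly_Mapping.lookup (a + b) 0)" for a b :: monom
    by (rule poly_mapping_eqI) (auto simp: lookup_add lookup_minus lookup_single when_def)
  then show ?thesis
    unfolding dehomogenize_def by (intro linext_mult[symmetric]) (simp add: mult_single)
qed

lemma dehomogenize_homogenize_at:
  assumes "0 \<notin> vars p"
  shows "dehomogenize (homogenize_at d p) = p"
proof -
  have "linext (\<lambda>m. linext (\<lambda>e. Poly_Mapping.single (e - Poly_Mapping.single 0 (Poly_Mapping.lookup e 0)) 1)
      (Poly_Mapping.single (m + Poly_Mapping.single 0 (d - monom_degree m)) 1)) p =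
      linext (\<lambda>m. Poly_Mapping.single m 1) p"
  proof (rule linext_cong)
    fix m assume "m \<in> Poly_Mapping.keys p"
    then have "Poly_Mapping.lookup m 0 = 0" using assms by (auto simp: vars_def in_keys_iff)
    then show "linext (\<lambda>e. Poly_Mapping.single (e - Poly_Mapping.single 0 (Poly_Mapping.lookup e 0)) 1)
      (Poly_Mapping.single (m + Poly_Mapping.single 0 (d - monom_degree m)) 1) = Poly_Mapping.single m 1"
      by (auto simp: linext_single scale_single lookup_add)
  qed
  then show ?thesis by (simp add: dehomogenize_def homogenize_at_def linext_linext linext_id)
qed

lemma poly_ring_nat_pow: "p [^]\<^bsub>poly_ring A\<^esub> (n::nat) = p ^ n"
proof -
  interpret cring "poly_ring A" by (rule cring_poly_ring)
  show ?thesis by (induction n) (simp_all add: mult.commute)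
qed

lemma deg_less_total_degree: "deg_less UNIV (Suc (total_degree p)) p"
  unfolding deg_less_def total_degree_def by (auto simp: less_Suc_eq_le intro!: Max_ge)

lemma deg_less_UNIV: "deg_less A d p \<Longrightarrow> deg_less UNIV d p"
  by (simp add: deg_less_def)

context
  fixes N :: nat
  assumes N: "2 \<le> N"
begin

lemma I_star_ideal: "ideal (I_tilde_star N) (poly_ring {0..N})"
  and gen_I_star: "i \<in> {1..N} \<Longrightarrow> homogenize (gen N i) \<in> I_tilde_star N"
proof -
  interpret cring "poly_ring {0..N}" by (rule cring_poly_ring)
  have g: "homogenize ` generators N \<subseteq> carrier (poly_ring {0..N})"
    using homogenize_generators_in_carrier N by simp
  show "ideal (I_tilde_star N) (poly_ring {0..N})" unfolding I_tilde_star_def by (rule genideal_ideal[OF g])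
  show "i \<in> {1..N} \<Longrightarrow> homogenize (gen N i) \<in> I_tilde_star N"
    unfolding I_tilde_star_def using genideal_self[OF g] by (auto simp: generators_eq[OF N])
qed

text \<open>The preimage of \<open>I_tilde N\<close> under the homomorphism
  \<open>dehomogenize\<close> is an ideal of the larger ring that contains the homogenized
  generators.\<close>

lemma dehomogenize_I_star:
  assumes "p \<in> I_tilde_star N"
  shows "dehomogenize p \<in> I_tilde N"
proof -
  let ?I = "{p. vars p \<subseteq> {0..N} \<and> dehomogenize p \<in> I_tilde N}"
  interpret cring "poly_ring {0..N}" by (rule cring_poly_ring)
  note D = ideal_poly_ringD[OF I_tilde_ideal[OF N]]
  have ins: "{0..N} = insert 0 {1..N}" by auto
  have "ideal ?I (poly_ring {0..N})"
  proof (rule ideal_poly_ringI)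
    show "p + q \<in> ?I" if "p \<in> ?I" "q \<in> ?I" for p q
      using that D(3) vars_add[of p q] by (auto simp: dehomogenize_def linext_add)
    show "p * q \<in> ?I" if "vars p \<subseteq> {0..N}" "q \<in> ?I" for p q
      using that D(4)[OF vars_dehomogenize[of p "{1..N}"]] vars_mult[of p q]
      unfolding ins by (auto simp: dehomogenize_mult)
  qed (use D(2) in \<open>auto simp: dehomogenize_def\<close>)
  moreover have "homogenize ` generators N \<subseteq> ?I"
  proof
    fix q assume q: "q \<in> homogenize ` generators N"
    then obtain i where i: "q = homogenize (gen N i)" "i \<in> {1..N}" by (auto simp: generators_eq[OF N])
    then have "0 \<notin> vars (gen N i)" using vars_gen[OF N i(2)] by auto
    then have "dehomogenize q \<in> I_tilde N"
      unfolding i(1) homogenize_eq using gen_I_tilde[OF N i(2)] by (simp add: dehomogenize_homogenize_at)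
    moreover have "vars q \<subseteq> {0..N}" using homogenize_generators_in_carrier[of N] N q by auto
    ultimately show "q \<in> ?I" by simp
  qed
  ultimately have "I_tilde_star N \<subseteq> ?I" unfolding I_tilde_star_def by (rule genideal_minimal)
  then show ?thesis using assms by blast
qed

text \<open>A representation of p^n by the generators can be homogenized term by term once the
  target degree is large enough. Padding p with a power of C_0 provides this degree, so the ideal
  generated by the homogenized generators alone suffices. Radicality removes the exponent, and C_0 =
  1 leads back.\<close>

lemma I_tilde_radical:
  assumes rad: "radical_ideal (I_tilde_star N) (poly_ring {0..N})"
    and p: "vars p \<subseteq> {1..N}" "0 < n" "p ^ n \<in> I_tilde N"
  shows "p \<in> I_tilde N"
proof -
  let ?A = "{1..N}" and ?t = "\<lambda>i. total_degree (gen N i)"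
  obtain h where h: "p ^ n = (\<Sum>i\<in>?A. h i * gen N i)" "\<And>i. vars (h i) \<subseteq> ?A"
    using I_tilde_elem[OF N p(3)] by metis
  obtain a where a: "deg_less ?A a p" using ex_deg_less[OF p(1)] ..
  have "\<forall>i. \<exists>d. deg_less ?A d (h i)" using ex_deg_less[OF h(2)] by blast
  then obtain d where d: "\<And>i. deg_less ?A (d i) (h i)" by metis
  \<comment> \<open>Chosen to dominate \<open>p\<close> and, since n is positive, to let
    \<open>m * n\<close> dominate all \<open>h i * gen N i\<close>.\<close>
  define m where "m = a + (\<Sum>i\<in>?A. d i + ?t i)"
  have m: "a \<le> m" "d i + ?t i \<le> m * n" if "i \<in> ?A" for i
  proof -
    show "a \<le> m" by (simp add: m_def)
    have "d i + ?t i \<le> m"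
      unfolding m_def using that member_le_sum[of i ?A "\<lambda>i. d i + ?t i"] by auto
    also have "\<dots> \<le> m * n" using p(2) by simp
    finally show "d i + ?t i \<le> m * n" .
  qed
  let ?H = "homogenize_at m p"
  have "a \<le> Suc m" by (simp add: m_def)
  then have "deg_less UNIV (Suc m) p"
    using deg_less_UNIV[OF deg_less_mono[OF a]] by blast
  then have "?H ^ n = homogenize_at (m * n) (p ^ n)" by (rule homogenize_at_power)
  also have "\<dots> = (\<Sum>i\<in>?A. homogenize_at (m * n) (h i * gen N i))"
    unfolding h(1) by (simp add: homogenize_at_def linext_sum)
  also have "\<dots> = (\<Sum>i\<in>?A. homogenize_at (m * n - ?t i) (h i) * homogenize (gen N i))"
  proof (rule sum.cong[OF refl])
    fix i assume i: "i \<in> ?A"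
    have "d i \<le> Suc (m * n - ?t i)" "m * n - ?t i + ?t i = m * n" using m(2)[OF i] by auto
    then show "homogenize_at (m * n) (h i * gen N i) =
        homogenize_at (m * n - ?t i) (h i) * homogenize (gen N i)"
      unfolding homogenize_eq
      using homogenize_at_mult[OF deg_less_UNIV[OF deg_less_mono[OF d]] deg_less_total_degree,
          of i "m * n - ?t i" "gen N i"]
      by simp
  qed
  also have "\<dots> \<in> I_tilde_star N"
  proof (rule ideal_poly_ring_sum[OF I_star_ideal])
    fix i assume i: "i \<in> ?A"
    have "vars (homogenize_at (m * n - ?t i) (h i)) \<subseteq> {0..N}"
      using vars_homogenize_at[OF h(2), of "m * n - ?t i" i] by fastforce
    then show "homogenize_at (m * n - ?t i) (h i) * homogenize (gen N i) \<in> I_tilde_star N"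
      using ideal_poly_ringD(4)[OF I_star_ideal] gen_I_star[OF i] by blast
  qed
  finally have "?H [^]\<^bsub>poly_ring {0..N}\<^esub> n \<in> I_tilde_star N" by (simp add: poly_ring_nat_pow)
  moreover have "?H \<in> carrier (poly_ring {0..N})"
    using vars_homogenize_at[OF p(1), of m] by fastforce
  ultimately have "?H \<in> radical (poly_ring {0..N}) (I_tilde_star N)"
    using p(2) unfolding radical_def by blast
  then have "?H \<in> I_tilde_star N" using rad unfolding radical_ideal_def by blast
  moreover have "0 \<notin> vars p" using p(1) by auto
  ultimately show ?thesis using dehomogenize_I_star[of ?H] by (simp add: dehomogenize_homogenize_at)
qed

end

section \<open>The Nullstellensatz from univariate equations\<close>

definition peval :: "complex poly \<Rightarrow> cpoly \<Rightarrow> cpoly"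
  where "peval q v = (\<Sum>i\<le>degree q. scale (coeff q i) (v ^ i))"

lemma peval_bound:
  assumes "degree q \<le> n"
  shows "peval q v = (\<Sum>i\<le>n. scale (coeff q i) (v ^ i))"
  unfolding peval_def using assms
  by (intro sum.mono_neutral_left) (auto simp: coeff_eq_0)

lemma peval_linear_mult: "peval ([:- z, 1:] * q) v = (v - Const z) * peval q v"
proof -
  let ?n = "degree q"
  have "degree ([:- z, 1:] * q) \<le> Suc ?n" using degree_mult_le[of "[:- z, 1:]" q] by simp
  then have "peval ([:- z, 1:] * q) v = (\<Sum>i\<le>Suc ?n. scale (coeff (pCons 0 q - smult z q) i) (v ^ i))"
    by (simp add: peval_bound)
  also have "\<dots> = (\<Sum>i\<le>Suc ?n. scale (coeff (pCons 0 q) i) (v ^ i)) -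
      (\<Sum>i\<le>Suc ?n. scale z (scale (coeff q i) (v ^ i)))"
    by (simp only: coeff_diff cp.scale_left_diff_distrib sum_subtractf coeff_smult cp.scale_scale)
  also have "(\<Sum>i\<le>Suc ?n. scale (coeff (pCons 0 q) i) (v ^ i)) = v * peval q v"
    by (simp add: sum.atMost_Suc_shift peval_def sum_distrib_left scale_def algebra_simps del: sum.atMost_Suc)
  also have "(\<Sum>i\<le>Suc ?n. scale z (scale (coeff q i) (v ^ i))) = Const z * peval q v"
    by (simp add: peval_def sum_distrib_left scale_def coeff_eq_0)
  finally show ?thesis by (simp add: left_diff_distrib)
qed

lemma adjoin_mono: "L \<subseteq> L' \<Longrightarrow> adjoin L a \<subseteq> adjoin L' a"
  by (auto simp: adjoin_def)

text \<open>An element that is not nilpotent modulo \<open>L\<close> stays so in one of the factors \<open>v = \<lambda>\<close> of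
  a split polynomial equation for \<open>v\<close>.\<close>

lemma not_nilpotent_specialize:
  assumes "is_ideal L" "\<And>n. p ^ n \<notin> L" "q \<noteq> 0" "peval q v \<in> L"
  shows "\<exists>z. \<forall>n. p ^ n \<notin> adjoin L (v - Const z)"
  using assms
proof (induction "degree q" arbitrary: q L)
  case 0
  then obtain c where c: "q = [:c:]" by (metis degree_eq_zeroE)
  with 0 have "scale (1 / c) (peval q v) \<in> L" "c \<noteq> 0" by (auto intro: is_ideal_scale)
  \<comment> \<open>The excluded powers include exponent 0, so \<open>L\<close> is a proper ideal
    and contains no nonzero constant.\<close>
  then have "p ^ 0 \<in> L" by (simp add: c peval_def)
  with 0 show ?case by blast
next
  case (Suc k)
  have "\<not> constant (poly q)" using Suc(2) by (simp add: constant_degree)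
  then obtain z where "poly q z = 0" using fundamental_theorem_of_algebra by blast
  then obtain q' where q': "q = [:- z, 1:] * q'" by (auto simp: poly_eq_0_iff_dvd elim: dvdE)
  with Suc(5) have "q' \<noteq> 0" by auto
  then have "degree q = 1 + degree q'" unfolding q' by (subst degree_mult_eq) auto
  then have k: "k = degree q'" using Suc(2) by simp
  show ?case
  proof (cases "\<forall>n. p ^ n \<notin> adjoin L (v - Const z)")
    case False
    then obtain n l h where n: "p ^ n = l + (v - Const z) * h" "l \<in> L" by (auto simp: adjoin_def)
    let ?L = "adjoin L (peval q' v)"
    have "p ^ m \<notin> ?L" for m
    proof
      assume "p ^ m \<in> ?L"
      then obtain l' h' where m: "p ^ m = l' + peval q' v * h'" "l' \<in> L" by (auto simp: adjoin_def)
      \<comment> \<open>The only term of the product without a factor from \<open>L\<close> contains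
        (v - z) q'(v) = q(v), which is in \<open>L\<close> as well.\<close>
      have "p ^ (n + m) = (p ^ m * l + ((v - Const z) * h) * l') + (h * h') * ((v - Const z) * peval q' v)"
        unfolding power_add n(1) m(1) by (simp add: algebra_simps)
      also have "\<dots> \<in> L"
      proof -
        have "(v - Const z) * peval q' v \<in> L" using Suc(6) unfolding q' peval_linear_mult .
        then show ?thesis
          using n(2) m(2) by (simp add: is_ideal_add[OF Suc(3)] is_ideal_mult[OF Suc(3)])
      qed
      finally show False using Suc(4) by blast
    qed
    then obtain y where "\<forall>n. p ^ n \<notin> adjoin ?L (v - Const y)"
      using Suc(1)[OF k is_ideal_adjoin[OF Suc(3)] _ \<open>q' \<noteq> 0\<close> adjoin_self[OF Suc(3)]] by blast
    then show ?thesis using adjoin_mono[OF adjoin_incl[of L "peval q' v"]] by blast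
  qed blast
qed

text \<open>The variables receive their values one at a time. The ideal only grows, so the equations
  of the remaining variables persist.\<close>

lemma specialize_all:
  assumes "is_ideal L" "\<And>n. p ^ n \<notin> L"
    and alg: "\<And>i. i \<in> {1..N} \<Longrightarrow> \<exists>q. q \<noteq> 0 \<and> peval q (var i) \<in> L"
  shows "\<exists>x M. is_ideal M \<and> L \<subseteq> M \<and> (\<forall>n. p ^ n \<notin> M) \<and> (\<forall>i\<in>{1..N}. var i - Const (x i) \<in> M)"
  using alg
proof (induction N)
  case 0
  then show ?case using assms by auto
next
  case (Suc N)
  then obtain x M where M: "is_ideal M" "L \<subseteq> M" "\<forall>n. p ^ n \<notin> M"
      "\<forall>i\<in>{1..N}. var i - Const (x i) \<in> M"
    by (metis atLeastAtMost_iff le_SucI)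
  obtain q where q: "q \<noteq> 0" "peval q (var (Suc N)) \<in> M" using Suc(2)[of "Suc N"] M(2) by auto
  obtain z where z: "\<forall>n. p ^ n \<notin> adjoin M (var (Suc N) - Const z)"
    using not_nilpotent_specialize[OF M(1) _ q] M(3) by blast
  let ?M = "adjoin M (var (Suc N) - Const z)"
  have "\<forall>i\<in>{1..Suc N}. var i - Const ((x(Suc N := z)) i) \<in> ?M"
  proof
    fix i assume "i \<in> {1..Suc N}"
    then have "i = Suc N \<or> i \<in> {1..N}" by auto
    then show "var i - Const ((x(Suc N := z)) i) \<in> ?M"
      using subsetD[OF adjoin_incl[of M]] M(4) adjoin_self[OF M(1)] by auto
  qed
  then show ?case
    using is_ideal_adjoin[OF M(1)] M(2) adjoin_incl z by (intro exI[of _ "x(Suc N := z)"] exI[of _ ?M]) blast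
qed

text \<open>The polynomials congruent to their value at x form a subring containing the constants
  and variables.\<close>

lemma mem_eval:
  assumes M: "is_ideal M" and x: "\<And>i. var i - Const (x i) \<in> M"
  shows "q - Const (eval_poly x q) \<in> M"
proof -
  have "q \<in> {q. q - Const (eval_poly x q) \<in> M}"
  proof (rule cpoly_generated)
    fix p q assume "p \<in> {q. q - Const (eval_poly x q) \<in> M}" "q \<in> {q. q - Const (eval_poly x q) \<in> M}"
    then have p: "p - Const (eval_poly x p) \<in> M" and q: "q - Const (eval_poly x q) \<in> M" by auto
    show "p + q \<in> {q. q - Const (eval_poly x q) \<in> M}"
      using is_ideal_add[OF M p q] by (simp add: eval_poly_add Const_add algebra_simps)
    have "q * (p - Const (eval_poly x p)) + Const (eval_poly x p) * (q - Const (eval_poly x q)) \<in> M"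
      using M p q by (intro is_ideal_add is_ideal_mult)
    then show "p * q \<in> {q. q - Const (eval_poly x q) \<in> M}"
      by (simp add: eval_poly_mult Const_mult algebra_simps)
  qed (use M x in \<open>auto simp: is_ideal_zero\<close>)
  then show ?thesis by simp
qed

text \<open>Modulo the specialized ideal each polynomial is its value at a point, with coordinate 0
  for the outer variables. A nonzero value on \<open>L\<close> would put a unit into this proper
  ideal, and the value 0 at p would put p into it.\<close>

lemma nullstellensatz_point:
  assumes L: "is_ideal L" "\<And>n. p ^ n \<notin> L"
    and alg: "\<And>i. i \<in> {1..N} \<Longrightarrow> \<exists>q. q \<noteq> 0 \<and> peval q (var i) \<in> L"
    and out: "\<And>i. i \<notin> {1..N} \<Longrightarrow> var i \<in> L"
  shows "\<exists>x. (\<forall>q\<in>L. eval_poly x q = 0) \<and> eval_poly x p \<noteq> 0"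
proof -
  obtain x M where M: "is_ideal M" "L \<subseteq> M" "\<forall>n. p ^ n \<notin> M" "\<forall>i\<in>{1..N}. var i - Const (x i) \<in> M"
    using specialize_all[OF L alg] by blast
  define y where "y i = (if i \<in> {1..N} then x i else 0)" for i
  have y: "q - Const (eval_poly y q) \<in> M" for q
    by (rule mem_eval[OF M(1)]) (use M(2,4) out in \<open>auto simp: y_def\<close>)
  have "eval_poly y q = 0" if "q \<in> L" for q
  proof (rule ccontr)
    let ?c = "eval_poly y q"
    assume c: "?c \<noteq> 0"
    have "q - (q - Const ?c) \<in> M" using that M(1,2) y[of q] by (blast intro: is_ideal_diff)
    then have "Const ?c \<in> M" by simp
    then have "scale (1 / ?c) (Const ?c) \<in> M" using M(1) by (simp add: is_ideal_scale)
    moreover have "scale (1 / ?c) (Const ?c) = 1" using c by (simp add: scale_def flip: Const_mult)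
    ultimately show False using M(3) by (metis power_0)
  qed
  moreover have "eval_poly y p \<noteq> 0" using y[of p] M(3) by (metis Const_simps(1) diff_zero power_one_right)
  ultimately show ?thesis by blast
qed

section \<open>Counting the zeros\<close>

text \<open>Lagrange interpolation: for each other point a coordinate separating it from x supplies
  a linear factor.\<close>

lemma interpolation:
  assumes "finite V" "V \<subseteq> {1..N} \<rightarrow>\<^sub>E UNIV" "x \<in> V"
  shows "\<exists>p. vars p \<subseteq> {1..N} \<and> (\<forall>y\<in>V. eval_poly y p = (if y = x then 1 else 0))"
proof -
  have "\<exists>i\<in>{1..N}. x i \<noteq> y i" if "y \<in> V - {x}" for y
  proof (rule ccontr)
    assume "\<not> ?thesis"
    then have "x = y" using assms(2,3) that by (intro PiE_ext[of x "{1..N}" "\<lambda>_. UNIV" y]) auto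
    then show False using that by blast
  qed
  then obtain i where i: "\<And>y. y \<in> V - {x} \<Longrightarrow> i y \<in> {1..N} \<and> x (i y) \<noteq> y (i y)" by metis
  define p where "p = (\<Prod>y\<in>V - {x}. scale (1 / (x (i y) - y (i y))) (var (i y) - Const (y (i y))))"
  have "vars p \<subseteq> {1..N}"
    unfolding p_def
  proof (rule vars_prod)
    fix y assume "y \<in> V - {x}"
    then show "vars (scale (1 / (x (i y) - y (i y))) (var (i y) - Const (y (i y)))) \<subseteq> {1..N}"
      using i[of y] vars_diff[of "var (i y)" "Const (y (i y))"]
        vars_scale[of "1 / (x (i y) - y (i y))" "var (i y) - Const (y (i y))"] by auto
  qed
  moreover have "eval_poly x p = 1"
    using i unfolding p_def eval_poly_prod by (intro prod.neutral) (auto simp: eval_poly_diff)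
  moreover have "eval_poly y p = 0" if "y \<in> V" "y \<noteq> x" for y
    using that assms(1) unfolding p_def eval_poly_prod
    by (intro prod_zero) (auto simp: eval_poly_diff intro!: bexI[of _ y])
  ultimately show ?thesis by (intro exI[of _ p]) auto
qed

context
  fixes N :: nat
  assumes N: "2 \<le> N"
begin

abbreviation (input) basis where "basis \<equiv> basis_monom N ` reduced_exps N"

lemma finite_basis: "finite basis"
  using card_reduced_exps(1)[OF N] by simp

lemma basis_relation:
  fixes n :: "nat \<Rightarrow> cpoly"
  assumes "\<And>j. n j \<in> cp.span basis"
  obtains d c j where "j \<le> d" "c j \<noteq> 0" "(\<Sum>j\<le>d. scale (c j) (n j)) = 0"
proof -
  let ?d = "card basis"
  show thesis
  proof (cases "inj_on n {..?d}")
    case True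
    have "cp.dependent (n ` {..?d})"
    proof (rule ccontr)
      assume "cp.independent (n ` {..?d})"
      then have "card (n ` {..?d}) \<le> ?d"
        using cp.independent_span_bound[OF finite_basis] assms by blast
      then show False using True by (simp add: card_image)
    qed
    then obtain u where u: "\<exists>v\<in>n ` {..?d}. u v \<noteq> 0" "(\<Sum>v\<in>n ` {..?d}. scale (u v) v) = 0"
      by (auto simp: cp.dependent_finite)
    then have "(\<Sum>j\<le>?d. scale (u (n j)) (n j)) = 0" "\<exists>j\<le>?d. u (n j) \<noteq> 0"
      using True by (auto simp: sum.reindex)
    then show thesis using that[of _ ?d "\<lambda>j. u (n j)"] by blast
  next
    case False
    then obtain j k where jk: "j \<le> ?d" "k \<le> ?d" "n j = n k" "j \<noteq> k" by (auto simp: inj_on_def)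
    \<comment> \<open>The image set does not see repeated values, so a repetition is turned into a
      relation with coefficients 1 and -1.\<close>
    define c :: "nat \<Rightarrow> complex" where "c i = (if i = j then 1 else 0) - (if i = k then 1 else 0)" for i
    have "(\<Sum>i\<le>?d. scale (c i) (n i)) =
        (\<Sum>i\<le>?d. if i = j then n i else 0) - (\<Sum>i\<le>?d. if i = k then n i else 0)"
      unfolding c_def cp.scale_left_diff_distrib sum_subtractf
      by (intro arg_cong2[of _ _ _ _ "(-)"] sum.cong) (auto simp: scale_def)
    then have "(\<Sum>i\<le>?d. scale (c i) (n i)) = 0" using jk by simp
    moreover have "c j \<noteq> 0" using jk by (simp add: c_def)
    ultimately show thesis using jk(1) that by blast
  qed
qed

text \<open>The normal forms of the powers of a variable lie in a finite-dimensional space; a linear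
  relation among them is a polynomial equation modulo the ideal.\<close>

lemma var_algebraic:
  assumes "i \<in> {1..N}"
  shows "\<exists>q. q \<noteq> 0 \<and> peval q (var i) \<in> I_tilde N"
proof -
  have "vars (var i ^ j) \<subseteq> {1..N}" for j
    using vars_prod[of "{..<j}" "\<lambda>_. var i" "{1..N}"] assms by simp
  then have "\<forall>j. \<exists>s. s \<in> cp.span basis \<and> var i ^ j - s \<in> I_tilde N"
    using normal_form[OF N] by blast
  then obtain n where n: "\<And>j. n j \<in> cp.span basis" "\<And>j. var i ^ j - n j \<in> I_tilde N" by metis
  obtain d c k where c: "k \<le> d" "c k \<noteq> 0" "(\<Sum>j\<le>d. scale (c j) (n j)) = 0"
    using n(1) by (rule basis_relation)
  define q where "q = (\<Sum>j\<le>d. monom (c j) j)"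
  have coeff: "coeff q j = (if j \<le> d then c j else 0)" for j
    by (simp add: q_def coeff_sum coeff_monom)
  have "q \<noteq> 0" using c(1,2) coeff[of k] by auto
  have "degree q \<le> d" using coeff by (intro degree_le) auto
  then have "peval q (var i) = (\<Sum>j\<le>d. scale (c j) (var i ^ j))"
    by (simp add: peval_bound coeff)
  also have "\<dots> = (\<Sum>j\<le>d. scale (c j) (var i ^ j - n j))"
    by (simp add: cp.scale_right_diff_distrib sum_subtractf c(3))
  also have "\<dots> \<in> I_tilde N"
    by (intro cp.subspace_sum cp.subspace_scale subspace_I_tilde N n(2))
  finally show ?thesis using \<open>q \<noteq> 0\<close> by blast
qed

text \<open>By radicality no power of a polynomial outside the ideal lies in it, which is the
  hypothesis of \<open>nullstellensatz_point\<close>. The ideal is extended to the whole type by its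
  preimage under the projection.\<close>

lemma nullstellensatz:
  assumes rad: "radical_ideal (I_tilde_star N) (poly_ring {0..N})"
    and p: "vars p \<subseteq> {1..N}" "p \<notin> I_tilde N"
  shows "\<exists>x\<in>zero_locus N (I_tilde N). eval_poly x p \<noteq> 0"
proof -
  let ?P = "mproj (\<lambda>m. Poly_Mapping.keys m \<subseteq> {1..N})"
  let ?L = "{q. ?P q \<in> I_tilde N}"
  note D = ideal_poly_ringD[OF I_tilde_ideal[OF N]]
  have P_id: "?P q = q" if "vars q \<subseteq> {1..N}" for q
    using that by (intro mproj_id) (auto simp: vars_def)
  have P_vars: "vars (?P q) \<subseteq> {1..N}" for q
    using keys_mproj[of "\<lambda>m. Poly_Mapping.keys m \<subseteq> {1..N}" q] unfolding vars_def by blast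
  have IL: "q \<in> ?L \<longleftrightarrow> q \<in> I_tilde N" if "vars q \<subseteq> {1..N}" for q
    using P_id[OF that] by simp
  have L: "is_ideal ?L"
    unfolding is_ideal_def
  proof (intro conjI ballI allI)
    show "0 \<in> ?L" using D(2) by (simp add: mproj_def)
    show "a + b \<in> ?L" if "a \<in> ?L" "b \<in> ?L" for a b
      using that D(3) by (simp add: mproj_def linext_add)
    show "a * b \<in> ?L" if "b \<in> ?L" for a b
    proof -
      have "?P (a * b) = ?P a * ?P b" by (rule mproj_mult) (simp add: keys_add_monom)
      then show ?thesis using D(4)[OF P_vars] that by simp
    qed
  qed
  have pn: "p ^ n \<notin> ?L" for n
  proof
    assume n: "p ^ n \<in> ?L"
    have "vars (p ^ n) \<subseteq> {1..N}" using vars_prod[of "{..<n}" "\<lambda>_. p" "{1..N}"] p(1) by simp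
    then have "p ^ n \<in> I_tilde N" using n IL by blast
    \<comment> \<open>Exponent 0 would put 1, and hence p, into the ideal.\<close>
    moreover from this have "0 < n" using D(4)[OF p(1), of 1] p(2) by (cases n) auto
    ultimately show False using I_tilde_radical[OF N rad p(1)] p(2) by blast
  qed
  have alg: "\<exists>q. q \<noteq> 0 \<and> peval q (var i) \<in> ?L" if "i \<in> {1..N}" for i
    using var_algebraic[OF that] D(1) IL by blast
  have out: "var i \<in> ?L" if "i \<notin> {1..N}" for i
  proof -
    have "?P (var i) = 0" using that by (intro mproj_null) (auto simp: var_def)
    then show ?thesis using D(2) by simp
  qed
  obtain x where x: "\<forall>q\<in>?L. eval_poly x q = 0" "eval_poly x p \<noteq> 0"
    using nullstellensatz_point[OF L pn alg out] by blast
  let ?x = "restrict x {1..N}"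
  have ev: "eval_poly ?x q = eval_poly x q" if "vars q \<subseteq> {1..N}" for q
    using that by (intro eval_poly_cong) auto
  have "eval_poly ?x q = 0" if "q \<in> I_tilde N" for q
    using x(1) IL[OF D(1)[OF that]] that ev[OF D(1)[OF that]] by auto
  then have "?x \<in> zero_locus N (I_tilde N)" by (simp add: zero_locus_def)
  moreover have "eval_poly ?x p \<noteq> 0" using ev[OF p(1)] x(2) by simp
  ultimately show ?thesis by blast
qed

text \<open>Passing to the normal form does not change the values of an interpolation polynomial at
  the zeros of the ideal.\<close>

lemma dual_elements:
  assumes "finite V" "V \<subseteq> zero_locus N (I_tilde N)"
  obtains n where "\<And>x. x \<in> V \<Longrightarrow> n x \<in> cp.span basis"
    "\<And>x y. x \<in> V \<Longrightarrow> y \<in> V \<Longrightarrow> eval_poly y (n x) = (if y = x then 1 else 0)"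
proof -
  have "\<exists>s\<in>cp.span basis. \<forall>y\<in>V. eval_poly y s = (if y = x then 1 else 0)" if "x \<in> V" for x
  proof -
    have "V \<subseteq> {1..N} \<rightarrow>\<^sub>E UNIV" using assms(2) by (auto simp: zero_locus_def)
    then obtain p where p: "vars p \<subseteq> {1..N}" "\<forall>y\<in>V. eval_poly y p = (if y = x then 1 else 0)"
      using interpolation[OF assms(1) _ \<open>x \<in> V\<close>] by blast
    obtain s where s: "s \<in> cp.span basis" "p - s \<in> I_tilde N" using normal_form[OF N p(1)] by blast
    have "eval_poly y s = eval_poly y p" if "y \<in> V" for y
    proof -
      have "eval_poly y (p - s) = 0" using that assms(2) s(2) by (auto simp: zero_locus_def)
      then show ?thesis by (simp add: eval_poly_diff)
    qed
    then show ?thesis using s(1) p(2) by (intro bexI[of _ s]) auto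
  qed
  then show thesis using that by metis
qed

text \<open>Evaluation at a zero isolates the coefficient of its dual element, so these are
  independent. The bound is for finite subsets, as it is also the source of finiteness.\<close>

lemma card_zeros_le:
  assumes V: "finite V" "V \<subseteq> zero_locus N (I_tilde N)"
  shows "card V \<le> card basis"
proof -
  obtain n where n: "\<And>x. x \<in> V \<Longrightarrow> n x \<in> cp.span basis"
    "\<And>x y. x \<in> V \<Longrightarrow> y \<in> V \<Longrightarrow> eval_poly y (n x) = (if y = x then 1 else 0)"
    using dual_elements[OF V] by blast
  have inj: "inj_on n V"
    by (rule inj_onI) (metis n(2) zero_neq_one)
  have "cp.independent (n ` V)"
  proof (rule cp.independent_if_scalars_zero)
    fix f v assume f: "(\<Sum>v\<in>n ` V. scale (f v) v) = 0" and "v \<in> n ` V"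
    then obtain x where x: "x \<in> V" "v = n x" by blast
    have "0 = eval_poly x (\<Sum>y\<in>V. scale (f (n y)) (n y))"
      using f by (simp add: sum.reindex[OF inj])
    also have "\<dots> = (\<Sum>y\<in>V. if x = y then f (n y) else 0)"
      unfolding eval_poly_sum using x(1) by (intro sum.cong) (auto simp: n(2))
    also have "\<dots> = f v" using x V(1) by simp
    finally show "f v = 0" by simp
  qed (use V(1) in simp)
  moreover have "n ` V \<subseteq> cp.span basis" using n(1) by blast
  ultimately have "card (n ` V) \<le> card basis" using cp.independent_span_bound[OF finite_basis] by blast
  then show ?thesis by (simp add: card_image[OF inj])
qed

text \<open>A basis monomial minus its interpolation by dual elements vanishes on all zeros, so it
  is in the ideal, and as a normal form it is zero. Hence the dual elements span.\<close>

lemma card_zeros_ge: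
  assumes rad: "radical_ideal (I_tilde_star N) (poly_ring {0..N})"
    and fin: "finite (zero_locus N (I_tilde N))"
  shows "card basis \<le> card (zero_locus N (I_tilde N))"
proof -
  let ?V = "zero_locus N (I_tilde N)"
  obtain n where n: "\<And>x. x \<in> ?V \<Longrightarrow> n x \<in> cp.span basis"
    "\<And>x y. x \<in> ?V \<Longrightarrow> y \<in> ?V \<Longrightarrow> eval_poly y (n x) = (if y = x then 1 else 0)"
    using dual_elements[OF fin order_refl] by blast
  have "basis \<subseteq> cp.span (n ` ?V)"
  proof
    fix b assume b: "b \<in> basis"
    let ?s = "\<Sum>x\<in>?V. scale (eval_poly x b) (n x)"
    have span: "b - ?s \<in> cp.span basis"
      using b n(1) by (intro cp.span_diff cp.span_sum cp.span_scale) (auto intro: cp.span_base)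
    have "eval_poly y (b - ?s) = 0" if y: "y \<in> ?V" for y
    proof -
      have "eval_poly y ?s = (\<Sum>x\<in>?V. if y = x then eval_poly x b else 0)"
        unfolding eval_poly_sum using y by (intro sum.cong) (auto simp: n(2))
      then show ?thesis using y fin by (simp add: eval_poly_diff)
    qed
    then have "b - ?s \<in> I_tilde N"
      using nullstellensatz[OF rad vars_basis_span[OF N span]] by blast
    then have "b - ?s = 0" by (rule I_tilde_disjoint[OF N span])
    then have "b = ?s" by simp
    also have "\<dots> \<in> cp.span (n ` ?V)" by (intro cp.span_sum cp.span_scale) (auto intro: cp.span_base)
    finally show "b \<in> cp.span (n ` ?V)" .
  qed
  then have "card basis \<le> card (n ` ?V)"
    using cp.independent_span_bound[OF _ basis_monom_independent[OF N]] fin by blast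
  also have "\<dots> \<le> card ?V" using fin by (rule card_image_le)
  finally show ?thesis .
qed

end

text \<open>For N = 1 the only generator is the constant 1 - (-1) = 2. The case is separate because
  the general argument needs generators of positive degree.\<close>

lemma zero_locus_one: "zero_locus 1 (I_tilde 1) = {}"
proof -
  interpret cring "poly_ring {1..1}" by (rule cring_poly_ring)
  have "alpha_tilde 1 \<in> I_tilde 1"
    using genideal_self[OF generators_in_carrier[of 1]] by (simp add: I_tilde_def generators_def)
  moreover have "alpha_tilde 1 = 1 + 1"
    by (simp add: alpha_tilde_def elem_sym_eq esym_zero)
  then have "eval_poly x (alpha_tilde 1) \<noteq> 0" for x by (simp only: eval_poly_add eval_poly_one) simp
  ultimately show ?thesis by (auto simp: zero_locus_def)
qed

theorem theorem3p5:
  fixes N :: nat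
  assumes "N > 0"
    and "radical_ideal (I_tilde_star N) (poly_ring {0..N})"
  shows "finite (zero_locus N (I_tilde N)) \<and>
    card (zero_locus N (I_tilde N)) = (N - 1) * fact (N - 1)"
proof (cases "N = 1")
  case True
  then show ?thesis by (simp add: zero_locus_one[simplified])
next
  case False
  with assms(1) have N: "2 \<le> N" by simp
  \<comment> \<open>A common bound for the sizes of all finite subsets makes the zero set
    finite.\<close>
  have "finite (zero_locus N (I_tilde N)) \<and>
      card (zero_locus N (I_tilde N)) \<le> card (basis_monom N ` reduced_exps N)"
    using card_zeros_le[OF N] by (intro finite_if_finite_subsets_card_bdd) blast
  then show ?thesis using card_zeros_ge[OF N assms(2)] card_basis_monom[OF N] by simp
qed

end
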